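(* If $x(t)$ is a solution to the reduced Chazy IV equation $$x'''=3xx''+3(x')^2-3x^2x',$$ then so are $$\frac{2xx'-x''}{x'},\qquad \frac{x^2-x'}{x},\qquad \frac{x^3-3xx'+x''}{x^2-x'},$$ $$-\frac{x'(x^3-3xx'+x'')}{x^2x'+(x')^2-xx''},\qquad \frac{x^2x'-xx''+(x')^2}{2xx'-x''}$$ (each whenever its denominator does not vanish identically). The first of these transformations is involutive, the second is of order three, and these two generate a group isomorphic to the symmetric group $S_3$, which contains the other three substitutions.
   Context: Solutions are (local) holomorphic or meromorphic functions of one complex variable $t$. A substitution $x\mapsto R(x,x',x'')$, with $R$ a rational function of three variables, is regarded as a transformation as follows: let $W=y\,\partial/\partial x+z\,\partial/\partial y+(3xz+3y^2-3x^2y)\,\partial/\partial z$ be the vector field on $\mathbb{C}^3$ equivalent to the equation (with $y=x'$, $z=x''$); the substitution is extended to $x'$ and $x''$ using the equation, giving the rational self-map $(x,y,z)\mapsto(R,\,W R,\,W(W R))$ of $\mathbb{C}^3$. Order, composition and group generated are understood for these rational self-maps of $\mathbb{C}^3$. *)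

theory Defs
  imports
    "HOL-Complex_Analysis.Complex_Analysis"
    "HOL-Computational_Algebra.Computational_Algebra"
    "HOL-Computational_Algebra.Field_as_Ring"
    "HOL-Algebra.Multiplicative_Group"
    "HOL-Algebra.Sym_Groups"
begin

text \<open>
  A solution is meromorphic on a domain \<open>U\<close>. The predicate \<open>meromorphic_on\<close> does not constrain
  the value at an isolated singularity, so the equation is required exactly at the points
  where \<open>x\<close> is analytic. The empty set is allowed as \<open>U\<close>.
\<close>

definition chazy_IV_solution :: "complex set \<Rightarrow> (complex \<Rightarrow> complex) \<Rightarrow> bool" where
  "chazy_IV_solution U x \<longleftrightarrow>
     open U \<and> connected U \<and> x meromorphic_on U \<and>
     (\<forall>t\<in>U. x analytic_on {t} \<longrightarrow>
        (deriv ^^ 3) x t =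
          3 * x t * (deriv ^^ 2) x t + 3 * (deriv x t)\<^sup>2 - 3 * (x t)\<^sup>2 * deriv x t)"

text \<open>
  \<open>D\<close> is a polynomial expression in \<open>x\<close> and its derivatives, so its value is only
  meaningful where \<open>x\<close> is analytic.
\<close>

definition nonvanishing_along ::
  "complex set \<Rightarrow> (complex \<Rightarrow> complex) \<Rightarrow> (complex \<Rightarrow> complex) \<Rightarrow> bool" where
  "nonvanishing_along U x D \<longleftrightarrow> (\<exists>t\<in>U. x analytic_on {t} \<and> D t \<noteq> 0)"

text \<open>
  The five substitutions, over an arbitrary field: they are used both for values of
  functions and for elements of the field of rational functions.
\<close>

definition R1 :: "'a::field \<Rightarrow> 'a \<Rightarrow> 'a \<Rightarrow> 'a" where
  "R1 x y z = (2 * x * y - z) / y"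

definition R2 :: "'a::field \<Rightarrow> 'a \<Rightarrow> 'a \<Rightarrow> 'a" where
  "R2 x y z = (x^2 - y) / x"

definition R3 :: "'a::field \<Rightarrow> 'a \<Rightarrow> 'a \<Rightarrow> 'a" where
  "R3 x y z = (x^3 - 3 * x * y + z) / (x^2 - y)"

definition R4 :: "'a::field \<Rightarrow> 'a \<Rightarrow> 'a \<Rightarrow> 'a" where
  "R4 x y z = - (y * (x^3 - 3 * x * y + z) / (x^2 * y + y^2 - x * z))"

definition R5 :: "'a::field \<Rightarrow> 'a \<Rightarrow> 'a \<Rightarrow> 'a" where
  "R5 x y z = (x^2 * y - x * z + y^2) / (2 * x * y - z)"

text \<open>
  \<open>\<complex>[x,y,z]\<close> is rendered as \<open>\<complex>[x][y][z]\<close>, with \<open>z\<close> the outermost variable, and \<open>\<complex>(x,y,z)\<close>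
  as its field of fractions.
\<close>

type_synonym poly3 = "complex poly poly poly"
type_synonym ratfun3 = "poly3 fract"

definition poly_x :: poly3 where "poly_x = [:[:[:0, 1:]:]:]"
definition poly_y :: poly3 where "poly_y = [:[:0, 1:]:]"
definition poly_z :: poly3 where "poly_z = [:0, 1:]"

definition rat_x :: ratfun3 where "rat_x = to_fract poly_x"
definition rat_y :: ratfun3 where "rat_y = to_fract poly_y"
definition rat_z :: ratfun3 where "rat_z = to_fract poly_z"

definition partial_x :: "poly3 \<Rightarrow> poly3" where "partial_x = map_poly (map_poly pderiv)"
definition partial_y :: "poly3 \<Rightarrow> poly3" where "partial_y = map_poly pderiv"
definition partial_z :: "poly3 \<Rightarrow> poly3" where "partial_z = pderiv"

definition W_poly :: "poly3 \<Rightarrow> poly3" where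
  "W_poly p =
     poly_y * partial_x p + poly_z * partial_y p +
     (3 * poly_x * poly_z + 3 * poly_y^2 - 3 * poly_x^2 * poly_y) * partial_z p"

text \<open>Extension of the derivation to fractions by the quotient rule.\<close>

definition W_rat :: "ratfun3 \<Rightarrow> ratfun3" where
  "W_rat f =
     (let (a, b) = quot_of_fract f
      in Fraction_Field.Fract (W_poly a * b - a * W_poly b) (b^2))"

type_synonym ratmap3 = "ratfun3 \<times> ratfun3 \<times> ratfun3"

definition extend_subst :: "ratfun3 \<Rightarrow> ratmap3" where
  "extend_subst R = (R, W_rat R, W_rat (W_rat R))"

fun eval_poly3 :: "poly3 \<Rightarrow> ratmap3 \<Rightarrow> ratfun3" where
  "eval_poly3 p (f, g, h) =
     poly (map_poly (\<lambda>q. poly (map_poly (\<lambda>r. poly (map_poly (\<lambda>c. to_fract [:[:[:c:]:]:]) r) f) q) g) p) h"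

text \<open>
  A rational self-map of \<open>\<complex>\<^sup>3\<close> can be substituted into arbitrary rational functions, and hence
  composed with arbitrary rational maps, precisely if it is dominant, that is, if its components
  are algebraically independent over \<open>\<complex>\<close>.
\<close>

definition dominant :: "ratmap3 \<Rightarrow> bool" where
  "dominant F \<longleftrightarrow> (\<forall>p. p \<noteq> 0 \<longrightarrow> eval_poly3 p F \<noteq> 0)"

definition subst_rat :: "ratfun3 \<Rightarrow> ratmap3 \<Rightarrow> ratfun3" where
  "subst_rat f G = (let (a, b) = quot_of_fract f in eval_poly3 a G / eval_poly3 b G)"

fun comp_ratmap :: "ratmap3 \<Rightarrow> ratmap3 \<Rightarrow> ratmap3" where
  "comp_ratmap (f, g, h) G = (subst_rat f G, subst_rat g G, subst_rat h G)"

definition dominant_ratmaps :: "ratmap3 monoid" where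
  "dominant_ratmaps =
     \<lparr>carrier = {F. dominant F}, mult = comp_ratmap, one = (rat_x, rat_y, rat_z)\<rparr>"

text \<open>The group of birational self-maps of \<open>\<complex>\<^sup>3\<close>.\<close>

definition birational_group :: "ratmap3 monoid" where
  "birational_group = units_of dominant_ratmaps"

end

theory Submission
  imports Defs
begin

text \<open>
  The quantity \<open>c = z - 3xy + x\<^sup>3\<close> is a first integral, and for \<open>x = -u'/u\<close> the equation becomes
  \<open>u''' = -c u\<close>. The second substitution is \<open>u \<mapsto> u'\<close>, hence has order three, and the first one
  is \<open>u \<mapsto> u'\<^sup>2 - u u''\<close>, which solves the equation with \<open>-c\<close> in place of \<open>c\<close>. The other three
  substitutions are \<open>R3 = R2 \<circ> R2\<close>, \<open>R4 = R1 \<circ> R2\<close>, \<open>R5 = R2 \<circ> R1\<close>, and \<open>R1 \<circ> R2 = R2 \<circ> R2 \<circ> R1\<close>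
  gives the relation of \<open>S\<^sub>3\<close>.
\<close>

section \<open>Identities between the substitutions\<close>

text \<open>Put \<open>v = u'^2 - u u''\<close>. Then \<open>u''' = -c u\<close> gives
  \<open>v' = u' u'' + c u^2\<close> and \<open>v'' = u''^2 + c u u'\<close>, so
  \<open>v'^2 - v v''\<close> is \<open>u\<close> times
  \<open>u''^3 - c u'^3 + 3 c u u' u'' + c^2 u^3\<close>. The last factor has derivative zero, and a
  constant factor does not change \<open>-u'/u\<close>: this is why the first substitution is
  involutive. The relation between the two generators holds because the first substitution sends
  \<open>u'\<close> to \<open>u''^2 - u' u''' = v''\<close>. Below, \<open>u\<close> stays implicit
  and everything is expressed in \<open>x\<close>, \<open>y\<close>, \<open>z\<close>. The obstacle
  is division. For functions, a composite agrees with its closed formula only where the intermediate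
  denominators do not vanish, so solutions are compared off a set without limit points in the
  domain. For rational maps, the laws of composition come from dominance, while the dominance of the
  generators is deduced from composites. This circle is broken by a weaker notion of regularity,
  which asks only that the denominators at hand survive a substitution.\<close>

text \<open>
  \<open>R1'\<close>, \<open>R1''\<close> are \<open>W R1\<close>, \<open>W (W R1)\<close>, and similarly for \<open>R2\<close>. The formulas come from computing in
  the coordinates \<open>(x, y, z/y)\<close> for \<open>R1\<close> and \<open>(x, y/x, z/x)\<close> for \<open>R2\<close>, in which \<open>W\<close> and the
  substitution are polynomial.
\<close>

definition R1' :: "'a::field \<Rightarrow> 'a \<Rightarrow> 'a \<Rightarrow> 'a" where
  "R1' x y z = - y - 3 * x * (z / y) + 3 * x^2 + (z / y)^2"

definition R1'' :: "'a::field \<Rightarrow> 'a \<Rightarrow> 'a \<Rightarrow> 'a" where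
  "R1'' x y z = 6 * x * y - 4 * z
     + (2 * (z / y) - 3 * x) * (3 * x * (z / y) + 3 * y - 3 * x^2 - (z / y)^2)"

definition R2' :: "'a::field \<Rightarrow> 'a \<Rightarrow> 'a \<Rightarrow> 'a" where
  "R2' x y z = y - z / x + (y / x)^2"

definition R2'' :: "'a::field \<Rightarrow> 'a \<Rightarrow> 'a \<Rightarrow> 'a" where
  "R2'' x y z = - 2 * z - 3 * (y / x) * y + 3 * x * y + 3 * (y / x) * (z / x) - 2 * (y / x)^3"

definition chazy :: "'a::comm_ring_1 \<Rightarrow> 'a \<Rightarrow> 'a \<Rightarrow> 'a" where
  "chazy x y z = 3 * x * z + 3 * y^2 - 3 * x^2 * y"

text \<open>In terms of \<open>p\<close> and \<open>q\<close>, a factor \<open>x\<close> cancels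
  between numerator and denominator of \<open>R3\<close>. Where \<open>x^2 = y\<close>, both sides
  are divisions by zero and still agree. \<open>z'\<close> stays free because \<open>R2\<close> is
  of first order.\<close>

lemma R2_R2:
  fixes x y z :: "'a::field"
  assumes "x \<noteq> 0"
  shows "R2 (R2 x y z) (R2' x y z) z' = R3 x y z"
proof -
  define p q where "p = y / x" and "q = z / x"
  hence yz: "y = p * x" "z = q * x" using assms by simp_all
  have 1: "R2 x y z = x - p" "R2' x y z = p * x - q + p^2"
    using assms by (simp_all add: R2_def R2'_def yz field_simps power2_eq_square)
  have 2: "x^3 - 3 * x * y + z = x * (x^2 - 3 * x * p + q)" "x^2 - y = x * (x - p)"
    by (simp_all add: yz algebra_simps power2_eq_square power3_eq_cube)
  have 3: "(x - p)^2 - (p * x - q + p^2) = x^2 - 3 * x * p + q"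
    by (simp add: algebra_simps power2_eq_square)
  show ?thesis
    unfolding 1 R3_def 2 R2_def[of "x - p"] 3 using assms by simp
qed

lemma R2_R1:
  fixes x y z :: "'a::field"
  assumes "y \<noteq> 0"
  shows "R2 (R1 x y z) (R1' x y z) z' = R5 x y z"
proof -
  define w where "w = z / y"
  hence z: "z = w * y" using assms by simp
  have 1: "R1 x y z = 2 * x - w" "R1' x y z = - y - 3 * x * w + 3 * x^2 + w^2"
    using assms by (simp_all add: R1_def R1'_def z field_simps)
  have 2: "x^2 * y - x * z + y^2 = y * (x^2 - x * w + y)" "2 * x * y - z = y * (2 * x - w)"
    by (simp_all add: z algebra_simps power2_eq_square)
  have 3: "(2 * x - w)^2 - (- y - 3 * x * w + 3 * x^2 + w^2) = x^2 - x * w + y"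
    by (simp add: algebra_simps power2_eq_square)
  show ?thesis
    unfolding 1 R5_def 2 R2_def[of "2 * x - w"] 3 using assms by simp
qed

lemma R2'_eq: "x \<noteq> 0 \<Longrightarrow> R2' x y z = (x^2 * y + y^2 - x * z) / x^2"
  for x y z :: "'a::field"
  by (simp add: R2'_def add_divide_distrib diff_divide_distrib power2_eq_square)

lemma R1_R2:
  fixes x y z :: "'a::field"
  assumes "x \<noteq> 0"
  shows "R1 (R2 x y z) (R2' x y z) (R2'' x y z) = R4 x y z"
proof -
  define p q where "p = y / x" and "q = z / x"
  hence yz: "y = p * x" "z = q * x" using assms by simp_all
  have 1: "R2 x y z = x - p" "R2' x y z = p * x - q + p^2"
      "R2'' x y z = - 2 * q * x - 3 * p * (p * x) + 3 * x * (p * x) + 3 * p * q - 2 * p^3"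
    using assms by (simp_all add: R2_def R2'_def R2''_def yz field_simps power2_eq_square)
  have 2: "x^3 - 3 * x * y + z = x * (x^2 - 3 * x * p + q)"
      "x^2 * y + y^2 - x * z = x^2 * (p * x - q + p^2)"
    by (simp_all add: yz algebra_simps power2_eq_square power3_eq_cube)
  \<comment> \<open>The bracket \<open>x^2 - 3 * x * p + q\<close> is the first integral
    \<open>c\<close> divided by \<open>x\<close>; this is the origin of the factor \<open>c\<close>
    in the numerator of \<open>R4\<close>.\<close>
  have 3: "2 * (x - p) * (p * x - q + p^2) -
      (- 2 * q * x - 3 * p * (p * x) + 3 * x * (p * x) + 3 * p * q - 2 * p^3)
      = - (p * (x^2 - 3 * x * p + q))"
    by (simp add: algebra_simps power2_eq_square power3_eq_cube)
  show ?thesis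
    unfolding 1 R4_def 2 R1_def[of "x - p"] 3 using assms by (simp add: yz power2_eq_square)
qed

text \<open>The numerator of the outer \<open>R1\<close> is \<open>x\<close> times its denominator
  \<open>R1'\<close>. In contrast to the other compositions, the right-hand side has no denominator
  that could degenerate along with it, hence the second hypothesis.\<close>

lemma R1_R1:
  fixes x y z :: "'a::field"
  assumes "y \<noteq> 0" "R1' x y z \<noteq> 0"
  shows "R1 (R1 x y z) (R1' x y z) (R1'' x y z) = x"
proof -
  define w where "w = z / y"
  hence z: "z = w * y" using assms by simp
  have 1: "R1 x y z = 2 * x - w" "R1' x y z = - y - 3 * x * w + 3 * x^2 + w^2"
     "R1'' x y z = 6 * x * y - 4 * (w * y) + (2 * w - 3 * x) * (3 * x * w + 3 * y - 3 * x^2 - w^2)"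
    using assms by (simp_all add: R1_def R1'_def R1''_def z field_simps)
  have "2 * R1 x y z * R1' x y z - R1'' x y z = x * R1' x y z"
    unfolding 1 by (simp add: algebra_simps power2_eq_square)
  thus ?thesis using assms(2) by (simp add: R1_def[of "R1 x y z"])
qed

text \<open>Since \<open>R3\<close> is the square of \<open>R2\<close>, comparison with
  \<open>R1_R2\<close> yields the relation of the symmetric group.\<close>

lemma R3_R1:
  fixes x y z :: "'a::field"
  assumes "y \<noteq> 0"
  shows "R3 (R1 x y z) (R1' x y z) (R1'' x y z) = R4 x y z"
proof -
  define w where "w = z / y"
  hence z: "z = w * y" using assms by simp
  have 1: "R1 x y z = 2 * x - w" "R1' x y z = - y - 3 * x * w + 3 * x^2 + w^2"
     "R1'' x y z = 6 * x * y - 4 * (w * y) + (2 * w - 3 * x) * (3 * x * w + 3 * y - 3 * x^2 - w^2)"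
    using assms by (simp_all add: R1_def R1'_def R1''_def z field_simps)
  \<comment> \<open>The left side is the first integral \<open>c\<close> at the image point:
    \<open>R1\<close> changes its sign.\<close>
  have 2: "R1 x y z ^ 3 - 3 * R1 x y z * R1' x y z + R1'' x y z = - (x^3 - 3 * x * y + z)"
    unfolding 1 by (simp add: algebra_simps power2_eq_square power3_eq_cube z)
  have 3: "x^2 * y + y^2 - x * z = y * (R1 x y z ^ 2 - R1' x y z)"
    unfolding 1 by (simp add: algebra_simps power2_eq_square z)
  show ?thesis
    unfolding R3_def 2 R4_def 3 using assms by (simp del: minus_add_distrib minus_diff_eq)
qed

section \<open>Meromorphic solutions\<close>

text \<open>Each equality between \<open>deriv\<close> and a candidate holds on a whole open set,
  and so can be differentiated again.\<close>

lemma analytic_derivs_on_open: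
  assumes "open S"
    and "\<And>s. s \<in> S \<Longrightarrow> (X has_field_derivative X1 s) (at s)"
    and "\<And>s. s \<in> S \<Longrightarrow> (X1 has_field_derivative X2 s) (at s)"
    and "\<And>s. s \<in> S \<Longrightarrow> (X2 has_field_derivative X3 s) (at s)"
    and "s \<in> S"
  shows "X analytic_on {s}" "deriv X s = X1 s" "(deriv ^^ 2) X s = X2 s" "(deriv ^^ 3) X s = X3 s"
proof -
  have 1: "deriv X u = X1 u" if "u \<in> S" for u
    using that assms by (auto intro: DERIV_imp_deriv)
  have 2: "(deriv X has_field_derivative X2 u) (at u)" if "u \<in> S" for u
    using has_field_derivative_transform_within_open[OF assms(3)[OF that] \<open>open S\<close> that] 1 by auto
  hence two: "deriv (deriv X) u = X2 u" if "u \<in> S" for u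
    using that assms by (auto intro: DERIV_imp_deriv)
  have 3: "(deriv (deriv X) has_field_derivative X3 u) (at u)" if "u \<in> S" for u
    using has_field_derivative_transform_within_open[OF assms(4)[OF that] \<open>open S\<close> that] two by auto
  hence three: "deriv (deriv (deriv X)) u = X3 u" if "u \<in> S" for u
    using that assms by (auto intro: DERIV_imp_deriv)
  show "X analytic_on {s}"
    using assms(1,2,5) by (metis analytic_at holomorphic_onI has_field_derivative_at_within field_differentiable_def)
  show "deriv X s = X1 s" "(deriv ^^ 2) X s = X2 s" "(deriv ^^ 3) X s = X3 s"
    using 1 two three assms(5) by (simp_all add: eval_nat_numeral)
qed

text \<open>Derivatives at a point depend on a neighbourhood, so generic pointwise statements have
  to be upgraded before they are differentiated. A point \<open>t\<close> near an exceptional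
  \<open>t0\<close> still has the neighbourhood \<open>S - {t0}\<close>.\<close>

lemma cosparse_imp_cosparse_nhds:
  fixes U :: "'a::t1_space set"
  assumes "open U" "\<forall>\<^sub>\<approx>t\<in>U. P t"
  shows "\<forall>\<^sub>\<approx>t\<in>U. \<forall>\<^sub>F s in nhds t. P s"
proof -
  have "\<forall>\<^sub>F t in at t0. \<forall>\<^sub>F s in nhds t. P s" if "t0 \<in> U" for t0
  proof -
    from assms that have "eventually P (at t0)"
      by (simp add: eventually_cosparse_open_eq)
    then obtain S where S: "open S" "t0 \<in> S" "\<And>s. s \<in> S \<Longrightarrow> s \<noteq> t0 \<Longrightarrow> P s"
      by (auto simp: eventually_at_topological)
    have "\<forall>\<^sub>F s in nhds t. P s" if "t \<in> S" "t \<noteq> t0" for t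
      unfolding eventually_nhds
      by (rule exI[of _ "S - {t0}"]) (use S that in auto)
    with S show ?thesis by (auto simp: eventually_at_topological)
  qed
  with assms show ?thesis by (simp add: eventually_cosparse_open_eq)
qed

text \<open>Analyticity is a conjunct here, whereas it is a premise in
  \<open>chazy_IV_solution\<close>: the predicate fails at poles, so its generic validity supplies
  the derivatives.\<close>

definition chazy_IV_at :: "(complex \<Rightarrow> complex) \<Rightarrow> complex \<Rightarrow> bool" where
  "chazy_IV_at x t \<longleftrightarrow> x analytic_on {t} \<and>
     (deriv ^^ 3) x t = chazy (x t) (deriv x t) ((deriv ^^ 2) x t)"

lemma isCont_eventually_eq_imp_eq:
  fixes h :: "complex \<Rightarrow> complex"
  assumes "isCont h t" "\<forall>\<^sub>F s in at t. h s = c"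
  shows "h t = c"
  using assms(1) tendsto_eventually[OF assms(2)] unfolding isCont_def by (rule LIM_unique)

text \<open>At an exceptional point where \<open>x\<close> is analytic, both sides of the equation
  are continuous and agree on a punctured neighbourhood. This allows discrete sets to be discarded
  in all that follows.\<close>

lemma chazy_IV_solution_iff_cosparse:
  "chazy_IV_solution U x \<longleftrightarrow>
     open U \<and> connected U \<and> x meromorphic_on U \<and> (\<forall>\<^sub>\<approx>t\<in>U. chazy_IV_at x t)"
proof (intro iffI conjI; (elim conjE)?)
  assume L: "chazy_IV_solution U x"
  show *: "open U" "connected U" "x meromorphic_on U"
    using L by (auto simp: chazy_IV_solution_def)
  show "\<forall>\<^sub>\<approx>t\<in>U. chazy_IV_at x t"
    using meromorphic_on_imp_analytic_cosparse[OF *(3)] eventually_in_cosparse[OF order_refl *(1)]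
  proof eventually_elim
    case (elim t)
    with L show ?case by (auto simp: chazy_IV_solution_def chazy_IV_at_def chazy_def)
  qed
next
  assume *: "open U" "connected U" "x meromorphic_on U" and ev: "\<forall>\<^sub>\<approx>t\<in>U. chazy_IV_at x t"
  have "(deriv ^^ 3) x t = chazy (x t) (deriv x t) ((deriv ^^ 2) x t)"
    if t: "t \<in> U" "x analytic_on {t}" for t
  proof -
    have an: "(\<lambda>t. (deriv ^^ 3) x t - chazy (x t) (deriv x t) ((deriv ^^ 2) x t)) analytic_on {t}"
      unfolding chazy_def using t(2)
      by (intro analytic_intros analytic_higher_deriv) auto
    from ev t * have "\<forall>\<^sub>F s in at t. chazy_IV_at x s"
      by (simp add: eventually_cosparse_open_eq)
    hence "\<forall>\<^sub>F s in at t. (deriv ^^ 3) x s - chazy (x s) (deriv x s) ((deriv ^^ 2) x s) = 0"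
      by eventually_elim (simp add: chazy_IV_at_def)
    moreover have "isCont (\<lambda>t. (deriv ^^ 3) x t - chazy (x t) (deriv x t) ((deriv ^^ 2) x t)) t"
      using an by (rule analytic_at_imp_isCont)
    ultimately have "(deriv ^^ 3) x t - chazy (x t) (deriv x t) ((deriv ^^ 2) x t) = 0"
      by (rule isCont_eventually_eq_imp_eq[rotated])
    thus ?thesis by simp
  qed
  with * show "chazy_IV_solution U x"
    by (auto simp: chazy_IV_solution_def chazy_def)
qed

text \<open>On a connected domain a meromorphic function is generically zero or generically nonzero.
  The first alternative contradicts continuity of \<open>D\<close> at the given point.\<close>

lemma nonvanishing_along_imp_cosparse:
  assumes "chazy_IV_solution U x" "nonvanishing_along U x D" "D meromorphic_on U"
    and "\<And>t. x analytic_on {t} \<Longrightarrow> D analytic_on {t}"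
  shows "\<forall>\<^sub>\<approx>t\<in>U. D t \<noteq> 0"
proof (rule ccontr)
  from assms(1) have U: "open U" "connected U" by (auto simp: chazy_IV_solution_def)
  assume "\<not> ?thesis"
  with meromorphic_imp_constant_or_avoid[OF assms(3) U, of 0]
  have "\<forall>\<^sub>\<approx>t\<in>U. D t = 0" by auto
  moreover from assms(2) obtain t where t: "t \<in> U" "x analytic_on {t}" "D t \<noteq> 0"
    by (auto simp: nonvanishing_along_def)
  ultimately have "\<forall>\<^sub>F s in at t. D s = 0"
    using U by (simp add: eventually_cosparse_open_eq)
  moreover have "isCont D t"
    using assms(4) t(2) analytic_at_imp_isCont by blast
  ultimately show False
    using t(3) isCont_eventually_eq_imp_eq by blast
qed

lemma chazy_IV_derivatives:
  assumes "chazy_IV_at x t"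
  shows "(x has_field_derivative deriv x t) (at t)"
    "(deriv x has_field_derivative (deriv ^^ 2) x t) (at t)"
    "((deriv ^^ 2) x has_field_derivative chazy (x t) (deriv x t) ((deriv ^^ 2) x t)) (at t)"
proof -
  have *: "((deriv ^^ n) x has_field_derivative (deriv ^^ Suc n) x t) (at t)" for n
    using assms analytic_on_imp_differentiable_at[OF analytic_higher_deriv, of x "{t}" t]
    by (simp add: chazy_IV_at_def DERIV_deriv_iff_field_differentiable)
  show "(x has_field_derivative deriv x t) (at t)"
    "(deriv x has_field_derivative (deriv ^^ 2) x t) (at t)"
    "((deriv ^^ 2) x has_field_derivative chazy (x t) (deriv x t) ((deriv ^^ 2) x t)) (at t)"
    using *[of 0] *[of 1] *[of 2] assms by (simp_all add: eval_nat_numeral chazy_IV_at_def)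
qed

text \<open>The derivatives are part of the conclusion so that a second substitution can be
  rewritten by the algebraic identities.\<close>

lemma R1_derivatives:
  assumes sol: "chazy_IV_solution U x" and nz: "\<forall>\<^sub>\<approx>t\<in>U. deriv x t \<noteq> 0"
  defines "X \<equiv> \<lambda>t. R1 (x t) (deriv x t) ((deriv ^^ 2) x t)"
  shows "\<forall>\<^sub>\<approx>t\<in>U. chazy_IV_at X t \<and>
           deriv X t = R1' (x t) (deriv x t) ((deriv ^^ 2) x t) \<and>
           (deriv ^^ 2) X t = R1'' (x t) (deriv x t) ((deriv ^^ 2) x t)"
proof -
  have "open U" using sol by (auto simp: chazy_IV_solution_def)
  have "\<forall>\<^sub>\<approx>t\<in>U. chazy_IV_at x t \<and> deriv x t \<noteq> 0"
    using sol nz by (auto simp: chazy_IV_solution_iff_cosparse intro: eventually_conj)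
  from cosparse_imp_cosparse_nhds[OF \<open>open U\<close> this] show ?thesis
  proof eventually_elim
    case (elim t)
    then obtain S where S: "open S" "t \<in> S" "\<And>s. s \<in> S \<Longrightarrow> chazy_IV_at x s"
        and y: "\<And>s. s \<in> S \<Longrightarrow> deriv x s \<noteq> 0"
      unfolding eventually_nhds by blast
    let ?y = "deriv x" and ?z = "(deriv ^^ 2) x"
    note d = S(3)[THEN chazy_IV_derivatives(1)] S(3)[THEN chazy_IV_derivatives(2)] S(3)[THEN chazy_IV_derivatives(3)]
    define w where "w = (\<lambda>s. ?z s / ?y s)"
    have zw: "?z s = w s * ?y s" if "s \<in> S" for s
      using y[OF that] by (simp add: w_def)
    \<comment> \<open>Dividing the equation by \<open>x'\<close> turns it into a Riccati equation
      for \<open>w\<close>; from here on no quotient has to be differentiated.\<close>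
    have dw: "(w has_field_derivative 3 * x s * w s + 3 * ?y s - 3 * x s ^ 2 - w s ^ 2) (at s)"
      if s: "s \<in> S" for s
      unfolding w_def[abs_def]
      by (rule DERIV_cong[OF DERIV_divide[OF d(3)[OF s] d(2)[OF s] y[OF s]]])
        (use y[OF s] in \<open>simp add: zw[OF s] chazy_def divide_eq_eq, simp add: algebra_simps power2_eq_square power3_eq_cube\<close>)
    have X: "X s = 2 * x s - w s" if "s \<in> S" for s
      using y[OF that] by (simp add: X_def R1_def w_def field_simps)
    define X1 where "X1 = (\<lambda>s. R1' (x s) (?y s) (?z s))"
    define X2 where "X2 = (\<lambda>s. R1'' (x s) (?y s) (?z s))"
    have X1: "X1 s = - ?y s - 3 * x s * w s + 3 * x s ^ 2 + w s ^ 2" for s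
      by (simp add: X1_def R1'_def w_def)
    have X2: "X2 s = 6 * x s * ?y s - 4 * ?z s +
       (2 * w s - 3 * x s) * (3 * x s * w s + 3 * ?y s - 3 * x s ^ 2 - w s ^ 2)" for s
      by (simp add: X2_def R1''_def w_def)
    have D: "(X has_field_derivative X1 s) (at s)" if s: "s \<in> S" for s
    proof (rule has_field_derivative_transform_within_open[OF _ S(1) s X[symmetric]])
      show "((\<lambda>s. 2 * x s - w s) has_field_derivative X1 s) (at s)"
        unfolding X1 by (rule derivative_eq_intros dw[OF s] d[OF s] refl)+ (simp_all add: algebra_simps power2_eq_square power3_eq_cube)
    qed
    have D1: "(X1 has_field_derivative X2 s) (at s)" if s: "s \<in> S" for s
      unfolding X1[abs_def] X2 zw[OF s]
      by (rule derivative_eq_intros dw[OF s] d[OF s] refl)+ (simp_all add: zw[OF s] algebra_simps power2_eq_square power3_eq_cube)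
    have D2: "(X2 has_field_derivative chazy (X s) (X1 s) (X2 s)) (at s)" if s: "s \<in> S" for s
      unfolding X2[abs_def] X1 X[OF s]
      by (rule derivative_eq_intros dw[OF s] d[OF s] refl)+ (simp_all add: zw[OF s] chazy_def algebra_simps power2_eq_square power3_eq_cube)
    from analytic_derivs_on_open[OF S(1) D D1 D2 S(2)] show ?case
      by (simp add: chazy_IV_at_def X1_def X2_def)
  qed
qed

lemma R2_derivatives:
  assumes sol: "chazy_IV_solution U x" and nz: "\<forall>\<^sub>\<approx>t\<in>U. x t \<noteq> 0"
  defines "X \<equiv> \<lambda>t. R2 (x t) (deriv x t) ((deriv ^^ 2) x t)"
  shows "\<forall>\<^sub>\<approx>t\<in>U. chazy_IV_at X t \<and>
           deriv X t = R2' (x t) (deriv x t) ((deriv ^^ 2) x t) \<and>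
           (deriv ^^ 2) X t = R2'' (x t) (deriv x t) ((deriv ^^ 2) x t)"
proof -
  have "open U" using sol by (auto simp: chazy_IV_solution_def)
  have "\<forall>\<^sub>\<approx>t\<in>U. chazy_IV_at x t \<and> x t \<noteq> 0"
    using sol nz by (auto simp: chazy_IV_solution_iff_cosparse intro: eventually_conj)
  from cosparse_imp_cosparse_nhds[OF \<open>open U\<close> this] show ?thesis
  proof eventually_elim
    case (elim t)
    then obtain S where S: "open S" "t \<in> S" "\<And>s. s \<in> S \<Longrightarrow> chazy_IV_at x s"
        and x: "\<And>s. s \<in> S \<Longrightarrow> x s \<noteq> 0"
      unfolding eventually_nhds by blast
    let ?y = "deriv x" and ?z = "(deriv ^^ 2) x"
    note d = S(3)[THEN chazy_IV_derivatives(1)] S(3)[THEN chazy_IV_derivatives(2)] S(3)[THEN chazy_IV_derivatives(3)]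
    define p where "p = (\<lambda>s. ?y s / x s)"
    define q where "q = (\<lambda>s. ?z s / x s)"
    have yp: "?y s = p s * x s" "?z s = q s * x s" if "s \<in> S" for s
      using x[OF that] by (simp_all add: p_def q_def)
    \<comment> \<open>The derivatives of \<open>x\<close>, \<open>p\<close> and \<open>q\<close> are
      polynomials in \<open>x\<close>, \<open>p\<close>, \<open>q\<close>, so the remaining checks
      are polynomial identities.\<close>
    have dp: "(p has_field_derivative q s - p s ^ 2) (at s)" if s: "s \<in> S" for s
      unfolding p_def[abs_def]
      by (rule DERIV_cong[OF DERIV_divide[OF d(2)[OF s] d(1)[OF s] x[OF s]]])
        (use x[OF s] in \<open>simp add: yp[OF s] divide_eq_eq, simp add: algebra_simps power2_eq_square power3_eq_cube\<close>)
    have dq: "(q has_field_derivative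
        3 * q s * x s + 3 * p s ^ 2 * x s - 3 * p s * x s ^ 2 - q s * p s) (at s)" if s: "s \<in> S" for s
      unfolding q_def[abs_def]
      by (rule DERIV_cong[OF DERIV_divide[OF d(3)[OF s] d(1)[OF s] x[OF s]]])
        (use x[OF s] in \<open>simp add: yp[OF s] chazy_def divide_eq_eq, simp add: algebra_simps power2_eq_square power3_eq_cube\<close>)
    have X: "X s = x s - p s" if "s \<in> S" for s
      using x[OF that] by (simp add: X_def R2_def p_def field_simps power2_eq_square)
    define X1 where "X1 = (\<lambda>s. R2' (x s) (?y s) (?z s))"
    define X2 where "X2 = (\<lambda>s. R2'' (x s) (?y s) (?z s))"
    have X1: "X1 s = ?y s - q s + p s ^ 2" for s
      by (simp add: X1_def R2'_def p_def q_def)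
    have X2: "X2 s = - 2 * ?z s - 3 * p s * ?y s + 3 * x s * ?y s + 3 * p s * q s - 2 * p s ^ 3" for s
      by (simp add: X2_def R2''_def p_def q_def)
    have D: "(X has_field_derivative X1 s) (at s)" if s: "s \<in> S" for s
    proof (rule has_field_derivative_transform_within_open[OF _ S(1) s X[symmetric]])
      show "((\<lambda>s. x s - p s) has_field_derivative X1 s) (at s)"
        unfolding X1 by (rule derivative_eq_intros dp[OF s] d[OF s] refl)+ (simp_all add: algebra_simps power2_eq_square power3_eq_cube)
    qed
    have D1: "(X1 has_field_derivative X2 s) (at s)" if s: "s \<in> S" for s
      unfolding X1[abs_def] X2
      by (rule derivative_eq_intros dp[OF s] dq[OF s] d[OF s] refl)+ (simp_all add: yp[OF s] algebra_simps power2_eq_square power3_eq_cube)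
    have D2: "(X2 has_field_derivative chazy (X s) (X1 s) (X2 s)) (at s)" if s: "s \<in> S" for s
      unfolding X2[abs_def] X1 X[OF s]
      by (rule derivative_eq_intros dp[OF s] dq[OF s] d[OF s] refl)+ (simp_all add: yp[OF s] chazy_def algebra_simps power2_eq_square power3_eq_cube)
    from analytic_derivs_on_open[OF S(1) D D1 D2 S(2)] show ?case
      by (simp add: chazy_IV_at_def X1_def X2_def)
  qed
qed

text \<open>A composite of two substitutions and its closed formula can differ at zeros of
  intermediate denominators, where division takes its default value.\<close>

lemma chazy_IV_solution_cong:
  assumes "chazy_IV_solution U X" "\<forall>\<^sub>\<approx>t\<in>U. X t = g t"
  shows "chazy_IV_solution U g"
proof -
  have U: "open U" "connected U" "X meromorphic_on U" and X: "\<forall>\<^sub>\<approx>t\<in>U. chazy_IV_at X t"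
    using assms(1) by (auto simp: chazy_IV_solution_iff_cosparse)
  have "\<forall>\<^sub>\<approx>t\<in>U. chazy_IV_at g t"
    using X cosparse_imp_cosparse_nhds[OF U(1) assms(2)]
  proof eventually_elim
    case (elim t)
    hence "(deriv ^^ n) X t = (deriv ^^ n) g t" for n
      by (intro higher_deriv_cong_ev) auto
    from this[of 0] this[of 1] this[of 2] this[of 3] elim show ?case
      using analytic_at_cong[OF elim(2) refl] by (simp add: chazy_IV_at_def)
  qed
  moreover have "g meromorphic_on U"
    using meromorphic_on_cong'[OF assms(2) refl] U(3) by simp
  ultimately show ?thesis
    using U by (simp add: chazy_IV_solution_iff_cosparse)
qed

text \<open>Here \<open>f\<close> is an intermediate denominator of a composite and \<open>D\<close>
  the denominator of the closed formula. If \<open>f\<close> were generically zero, it would vanish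
  near generic points together with its derivatives, and \<open>D\<close> would vanish there
  too.\<close>

lemma cosparse_nonzero_if_implied:
  assumes "open U" "connected U" "f meromorphic_on U" "\<forall>\<^sub>\<approx>t\<in>U. D t \<noteq> 0"
    and zero: "\<And>t. \<forall>\<^sub>F s in nhds t. f s = 0 \<Longrightarrow> D t = 0"
  shows "\<forall>\<^sub>\<approx>t\<in>U. f t \<noteq> 0"
  using meromorphic_imp_constant_or_avoid[OF assms(3,1,2), of 0]
proof
  assume "\<forall>\<^sub>\<approx>t\<in>U. f t = 0"
  from assms(4) cosparse_imp_cosparse_nhds[OF assms(1) this] show ?thesis
    by eventually_elim (use zero in blast)
qed

lemma higher_deriv_eventually_zero:
  assumes "\<forall>\<^sub>F s in nhds t. f s = 0"
  shows "(deriv ^^ n) f t = 0"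
  using higher_deriv_cong_ev[of f "\<lambda>_. 0" t t n] assms by simp

section \<open>The five substitutions on meromorphic solutions\<close>

lemma chazy_IV_solution_R1:
  assumes "chazy_IV_solution U x" "\<forall>\<^sub>\<approx>t\<in>U. deriv x t \<noteq> 0"
  shows "chazy_IV_solution U (\<lambda>t. R1 (x t) (deriv x t) ((deriv ^^ 2) x t))"
  using assms eventually_mono[OF R1_derivatives[OF assms]]
  by (auto simp: chazy_IV_solution_iff_cosparse R1_def intro!: meromorphic_intros)

lemma chazy_IV_solution_R2:
  assumes "chazy_IV_solution U x" "\<forall>\<^sub>\<approx>t\<in>U. x t \<noteq> 0"
  shows "chazy_IV_solution U (\<lambda>t. R2 (x t) (deriv x t) ((deriv ^^ 2) x t))"
  using assms eventually_mono[OF R2_derivatives[OF assms]]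
  by (auto simp: chazy_IV_solution_iff_cosparse R2_def intro!: meromorphic_intros)

text \<open>\<open>R2\<close> is applied twice. The single hypothesis on \<open>x^2 - x'\<close>
  controls both denominators: it excludes that \<open>x\<close> vanishes identically, and it is the
  numerator of the intermediate solution \<open>X\<close>.\<close>

lemma chazy_IV_solution_R3:
  assumes x: "chazy_IV_solution U x" and D: "\<forall>\<^sub>\<approx>t\<in>U. (x t)^2 - deriv x t \<noteq> 0"
  shows "chazy_IV_solution U (\<lambda>t. R3 (x t) (deriv x t) ((deriv ^^ 2) x t))"
proof -
  have U: "open U" "connected U" "x meromorphic_on U"
    using x by (auto simp: chazy_IV_solution_def)
  have nz: "\<forall>\<^sub>\<approx>t\<in>U. x t \<noteq> 0"
  proof (rule cosparse_nonzero_if_implied[OF U D])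
    fix t assume *: "\<forall>\<^sub>F s in nhds t. x s = 0"
    from higher_deriv_eventually_zero[OF this, of 0] higher_deriv_eventually_zero[OF this, of 1]
    show "(x t)^2 - deriv x t = 0" by simp
  qed
  define X where "X = (\<lambda>t. R2 (x t) (deriv x t) ((deriv ^^ 2) x t))"
  have X: "chazy_IV_solution U X"
    unfolding X_def by (rule chazy_IV_solution_R2[OF x nz])
  from D nz have "\<forall>\<^sub>\<approx>t\<in>U. X t \<noteq> 0"
    by eventually_elim (auto simp: X_def R2_def)
  note chazy_IV_solution_R2[OF X this]
  moreover have "\<forall>\<^sub>\<approx>t\<in>U. R2 (X t) (deriv X t) ((deriv ^^ 2) X t) = R3 (x t) (deriv x t) ((deriv ^^ 2) x t)"
    using R2_derivatives[OF x nz] nz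
    by eventually_elim (auto simp flip: X_def simp: R2_R2, simp add: X_def R2_R2)
  ultimately show ?thesis by (rule chazy_IV_solution_cong)
qed

lemma chazy_IV_solution_R4:
  assumes x: "chazy_IV_solution U x"
    and D: "\<forall>\<^sub>\<approx>t\<in>U. (x t)^2 * deriv x t + (deriv x t)^2 - x t * (deriv ^^ 2) x t \<noteq> 0"
  shows "chazy_IV_solution U (\<lambda>t. R4 (x t) (deriv x t) ((deriv ^^ 2) x t))"
proof -
  have U: "open U" "connected U" "x meromorphic_on U"
    using x by (auto simp: chazy_IV_solution_def)
  have nz: "\<forall>\<^sub>\<approx>t\<in>U. x t \<noteq> 0"
  proof (rule cosparse_nonzero_if_implied[OF U D])
    fix t assume *: "\<forall>\<^sub>F s in nhds t. x s = 0"
    from higher_deriv_eventually_zero[OF this, of 0] higher_deriv_eventually_zero[OF this, of 1]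
    show "(x t)^2 * deriv x t + (deriv x t)^2 - x t * (deriv ^^ 2) x t = 0" by simp
  qed
  define X where "X = (\<lambda>t. R2 (x t) (deriv x t) ((deriv ^^ 2) x t))"
  have X: "chazy_IV_solution U X"
    unfolding X_def by (rule chazy_IV_solution_R2[OF x nz])
  have dX: "\<forall>\<^sub>\<approx>t\<in>U. deriv X t = R2' (x t) (deriv x t) ((deriv ^^ 2) x t) \<and>
      (deriv ^^ 2) X t = R2'' (x t) (deriv x t) ((deriv ^^ 2) x t)"
    using R2_derivatives[OF x nz] unfolding X_def by eventually_elim auto
  \<comment> \<open>The denominator of \<open>R4\<close> is \<open>x^2\<close> times
    \<open>R2'\<close>, and \<open>R2'\<close> is the derivative of \<open>X\<close>.\<close>
  from D nz dX have "\<forall>\<^sub>\<approx>t\<in>U. deriv X t \<noteq> 0"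
    by eventually_elim (simp add: R2'_eq)
  note chazy_IV_solution_R1[OF X this]
  moreover have "\<forall>\<^sub>\<approx>t\<in>U. R1 (X t) (deriv X t) ((deriv ^^ 2) X t) = R4 (x t) (deriv x t) ((deriv ^^ 2) x t)"
    using dX nz by eventually_elim (simp add: X_def R1_R2)
  ultimately show ?thesis by (rule chazy_IV_solution_cong)
qed

lemma chazy_IV_solution_R5:
  assumes x: "chazy_IV_solution U x"
    and D: "\<forall>\<^sub>\<approx>t\<in>U. 2 * x t * deriv x t - (deriv ^^ 2) x t \<noteq> 0"
  shows "chazy_IV_solution U (\<lambda>t. R5 (x t) (deriv x t) ((deriv ^^ 2) x t))"
proof -
  have U: "open U" "connected U" "x meromorphic_on U"
    using x by (auto simp: chazy_IV_solution_def)
  have nz: "\<forall>\<^sub>\<approx>t\<in>U. deriv x t \<noteq> 0"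
  proof (rule cosparse_nonzero_if_implied[OF U(1,2) _ D])
    fix t assume *: "\<forall>\<^sub>F s in nhds t. deriv x s = 0"
    from higher_deriv_eventually_zero[OF this, of 0] higher_deriv_eventually_zero[OF this, of 1]
    show "2 * x t * deriv x t - (deriv ^^ 2) x t = 0" by (simp add: eval_nat_numeral)
  qed (use U in \<open>auto intro: meromorphic_intros\<close>)
  define X where "X = (\<lambda>t. R1 (x t) (deriv x t) ((deriv ^^ 2) x t))"
  have X: "chazy_IV_solution U X"
    unfolding X_def by (rule chazy_IV_solution_R1[OF x nz])
  \<comment> \<open>The numerator of \<open>X\<close> is the denominator of
    \<open>R5\<close>.\<close>
  from D nz have "\<forall>\<^sub>\<approx>t\<in>U. X t \<noteq> 0"
    by eventually_elim (auto simp: X_def R1_def)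
  note chazy_IV_solution_R2[OF X this]
  moreover have "\<forall>\<^sub>\<approx>t\<in>U. deriv X t = R1' (x t) (deriv x t) ((deriv ^^ 2) x t)"
    using R1_derivatives[OF x nz] unfolding X_def by eventually_elim auto
  hence "\<forall>\<^sub>\<approx>t\<in>U. R2 (X t) (deriv X t) ((deriv ^^ 2) X t) = R5 (x t) (deriv x t) ((deriv ^^ 2) x t)"
    using nz by eventually_elim (simp add: X_def R2_R1)
  ultimately show ?thesis by (rule chazy_IV_solution_cong)
qed

lemma chazy_IV_substitutions:
  fixes U :: "complex set" and x :: "complex \<Rightarrow> complex"
  assumes x: "chazy_IV_solution U x"
  defines "y \<equiv> deriv x" and "z \<equiv> (deriv ^^ 2) x"
  shows "nonvanishing_along U x y \<Longrightarrow>
           chazy_IV_solution U (\<lambda>t. R1 (x t) (y t) (z t))"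
    and "nonvanishing_along U x x \<Longrightarrow>
           chazy_IV_solution U (\<lambda>t. R2 (x t) (y t) (z t))"
    and "nonvanishing_along U x (\<lambda>t. (x t)^2 - y t) \<Longrightarrow>
           chazy_IV_solution U (\<lambda>t. R3 (x t) (y t) (z t))"
    and "nonvanishing_along U x (\<lambda>t. (x t)^2 * y t + (y t)^2 - x t * z t) \<Longrightarrow>
           chazy_IV_solution U (\<lambda>t. R4 (x t) (y t) (z t))"
    and "nonvanishing_along U x (\<lambda>t. 2 * x t * y t - z t) \<Longrightarrow>
           chazy_IV_solution U (\<lambda>t. R5 (x t) (y t) (z t))"
proof -
  have "x meromorphic_on U" using x by (simp add: chazy_IV_solution_def)
  hence mero: "x meromorphic_on U" "y meromorphic_on U" "z meromorphic_on U"
    unfolding y_def z_def by (auto intro: meromorphic_intros)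
  have an: "y analytic_on {t}" "z analytic_on {t}" if "x analytic_on {t}" for t
    using that unfolding y_def z_def by (auto intro: analytic_intros)
  note nonvanishing = nonvanishing_along_imp_cosparse[OF x]
  show "nonvanishing_along U x y \<Longrightarrow> chazy_IV_solution U (\<lambda>t. R1 (x t) (y t) (z t))"
    using chazy_IV_solution_R1[OF x] nonvanishing[of y] mero an unfolding y_def z_def by blast
  show "nonvanishing_along U x x \<Longrightarrow> chazy_IV_solution U (\<lambda>t. R2 (x t) (y t) (z t))"
    using chazy_IV_solution_R2[OF x] nonvanishing[of x] mero unfolding y_def z_def by blast
  show "chazy_IV_solution U (\<lambda>t. R3 (x t) (y t) (z t))"
    if "nonvanishing_along U x (\<lambda>t. (x t)^2 - y t)"
  proof -
    have "\<forall>\<^sub>\<approx>t\<in>U. (x t)^2 - y t \<noteq> 0"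
      by (rule nonvanishing[OF that]) (auto intro!: meromorphic_intros analytic_intros mero an)
    thus ?thesis
      unfolding y_def z_def by (rule chazy_IV_solution_R3[OF x])
  qed
  show "chazy_IV_solution U (\<lambda>t. R4 (x t) (y t) (z t))"
    if "nonvanishing_along U x (\<lambda>t. (x t)^2 * y t + (y t)^2 - x t * z t)"
  proof -
    have "\<forall>\<^sub>\<approx>t\<in>U. (x t)^2 * y t + (y t)^2 - x t * z t \<noteq> 0"
      by (rule nonvanishing[OF that]) (auto intro!: meromorphic_intros analytic_intros mero an)
    thus ?thesis
      unfolding y_def z_def by (rule chazy_IV_solution_R4[OF x])
  qed
  show "chazy_IV_solution U (\<lambda>t. R5 (x t) (y t) (z t))"
    if "nonvanishing_along U x (\<lambda>t. 2 * x t * y t - z t)"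
  proof -
    have "\<forall>\<^sub>\<approx>t\<in>U. 2 * x t * y t - z t \<noteq> 0"
      by (rule nonvanishing[OF that]) (auto intro!: meromorphic_intros analytic_intros mero an)
    thus ?thesis
      unfolding y_def z_def by (rule chazy_IV_solution_R5[OF x])
  qed
qed

section \<open>Substitution into rational functions\<close>

definition const3 :: "complex \<Rightarrow> poly3" where
  "const3 c = [:[:[:c:]:]:]"

text \<open>Hides the nesting of the polynomial ring: statements compatible with sums and products
  need checking only on constants and the three variables.\<close>

lemma poly3_induct [case_names const x y z add mult]:
  fixes p :: poly3
  assumes const: "\<And>c. P (const3 c)" and x: "P poly_x" and y: "P poly_y" and z: "P poly_z"
    and add: "\<And>p q. P p \<Longrightarrow> P q \<Longrightarrow> P (p + q)"
    and mult: "\<And>p q. P p \<Longrightarrow> P q \<Longrightarrow> P (p * q)"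
  shows "P p"
proof -
  have 1: "P [:[:r:]:]" for r
  proof (induction r)
    case 0
    then show ?case using const[of 0] by (simp add: const3_def)
  next
    case (pCons c r)
    have "[:[:pCons c r:]:] = const3 c + poly_x * [:[:r:]:]"
      by (simp add: const3_def poly_x_def)
    with pCons const x add mult show ?case by metis
  qed
  have 2: "P [:q:]" for q
  proof (induction q)
    case 0
    then show ?case using const[of 0] by (simp add: const3_def)
  next
    case (pCons r q)
    have "[:pCons r q:] = [:[:r:]:] + poly_y * [:q:]"
      by (simp add: poly_y_def)
    with pCons 1 y add mult show ?case by metis
  qed
  show ?thesis
  proof (induction p)
    case 0
    then show ?case using const[of 0] by (simp add: const3_def)
  next
    case (pCons q p)
    have "pCons q p = [:q:] + poly_z * p"
      by (simp add: poly_z_def)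
    with pCons 2 z add mult show ?case by metis
  qed
qed

definition ring_morphism :: "('a::comm_ring_1 \<Rightarrow> 'b::comm_ring_1) \<Rightarrow> bool" where
  "ring_morphism h \<longleftrightarrow> h 0 = 0 \<and> h 1 = 1 \<and>
     (\<forall>a b. h (a + b) = h a + h b) \<and> (\<forall>a b. h (a * b) = h a * h b)"

text \<open>One layer of \<open>eval_poly3\<close>; iterating it three times gives the whole
  evaluation.\<close>

lemma ring_morphism_poly_map_poly:
  assumes "ring_morphism h"
  shows "ring_morphism (\<lambda>p. poly (map_poly h p) a)"
proof -
  have h: "h 0 = 0" "h 1 = 1" "h (a + b) = h a + h b" "h (a * b) = h a * h b" for a b
    using assms by (auto simp: ring_morphism_def)
  have add: "map_poly h (p + q) = map_poly h p + map_poly h q" for p q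
    by (rule poly_eqI) (simp add: coeff_map_poly h)
  have smult: "map_poly h (Polynomial.smult c p) = Polynomial.smult (h c) (map_poly h p)" for c p
    by (rule poly_eqI) (simp add: coeff_map_poly h)
  have mult: "map_poly h (p * q) = map_poly h p * map_poly h q" for p q
    by (induction p) (simp_all add: map_poly_pCons h add smult)
  show ?thesis
    by (simp add: ring_morphism_def h add mult map_poly_1')
qed

lemma ring_morphism_eval_poly3: "ring_morphism (\<lambda>p. eval_poly3 p F)"
proof -
  have "ring_morphism (\<lambda>c. to_fract [:[:[:c:]:]:] :: ratfun3)"
    by (simp add: ring_morphism_def flip: to_fract_add to_fract_mult one_pCons)
  from ring_morphism_poly_map_poly[OF ring_morphism_poly_map_poly[OF ring_morphism_poly_map_poly[OF this]]]
  show ?thesis by (cases F) simp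
qed

lemma eval_poly3_0 [simp]: "eval_poly3 0 F = 0"
  and eval_poly3_1 [simp]: "eval_poly3 1 F = 1"
  and eval_poly3_add [simp]: "eval_poly3 (p + q) F = eval_poly3 p F + eval_poly3 q F"
  and eval_poly3_mult [simp]: "eval_poly3 (p * q) F = eval_poly3 p F * eval_poly3 q F"
  using ring_morphism_eval_poly3[of F] unfolding ring_morphism_def by blast+

declare eval_poly3.simps [simp del]

lemma eval_poly3_const [simp]: "eval_poly3 (const3 c) F = to_fract (const3 c)"
  and eval_poly3_x [simp]: "eval_poly3 poly_x (f, g, h) = f"
  and eval_poly3_y [simp]: "eval_poly3 poly_y (f, g, h) = g"
  and eval_poly3_z [simp]: "eval_poly3 poly_z (f, g, h) = h"
  by (cases F; simp add: eval_poly3.simps const3_def poly_x_def poly_y_def poly_z_def map_poly_pCons one_pCons[symmetric])+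

lemma eval_poly3_id: "eval_poly3 p (rat_x, rat_y, rat_z) = to_fract p"
  by (induction p rule: poly3_induct) (simp_all add: rat_x_def rat_y_def rat_z_def)

lemma ratfun_cases:
  fixes f :: ratfun3
  obtains a b where "f = to_fract a / to_fract b" "b \<noteq> 0"
  by (cases f) (auto simp: to_fract_def intro: that)

text \<open>Fractions are reduced in \<open>subst_rat\<close>, so it suffices to find some denominator that does not
  vanish under the substitution.\<close>

lemma subst_rat_quotient:
  assumes b: "eval_poly3 b G \<noteq> 0"
  shows "subst_rat (to_fract a / to_fract b) G = eval_poly3 a G / eval_poly3 b G"
proof -
  obtain a0 b0 where q: "quot_of_fract (to_fract a / to_fract b) = (a0, b0)" by fastforce
  have b0: "b \<noteq> 0" using b by auto
  have "quot_of_fract (to_fract a / to_fract b) = normalize_quot (a, b)"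
    using b0 quot_of_fract_quot_to_fract[of "(a, b)"] by (simp add: quot_to_fract_def to_fract_def)
  with normalize_quotE[OF b0, of a] q obtain d where d: "a = a0 * d" "b = b0 * d"
    by (metis fst_conv snd_conv)
  have "subst_rat (to_fract a / to_fract b) G = eval_poly3 a0 G / eval_poly3 b0 G"
    by (simp only: subst_rat_def q) simp
  with b show "subst_rat (to_fract a / to_fract b) G = eval_poly3 a G / eval_poly3 b G"
    by (simp add: d)
qed

text \<open>Condition on a single function under which substitution is compatible with the field
  operations. Dominance of \<open>G\<close> implies it for every \<open>f\<close>, but it can be
  verified by hand before dominance is known.\<close>

definition regular_at :: "ratfun3 \<Rightarrow> ratmap3 \<Rightarrow> bool" where
  "regular_at f G \<longleftrightarrow> (\<exists>a b. f = to_fract a / to_fract b \<and> eval_poly3 b G \<noteq> 0)"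

lemma regular_atE:
  assumes "regular_at f G"
  obtains a b where "f = to_fract a / to_fract b" "b \<noteq> 0" "eval_poly3 b G \<noteq> 0"
    "subst_rat f G = eval_poly3 a G / eval_poly3 b G"
  using assms subst_rat_quotient unfolding regular_at_def by (metis eval_poly3_0)

lemma subst_rat_to_fract [simp]: "subst_rat (to_fract p) G = eval_poly3 p G"
  and regular_at_to_fract [simp]: "regular_at (to_fract p) G"
proof -
  show "subst_rat (to_fract p) G = eval_poly3 p G"
    using subst_rat_quotient[of 1 G p] by simp
  have "to_fract p = to_fract p / to_fract 1" "eval_poly3 1 G \<noteq> 0" by simp_all
  thus "regular_at (to_fract p) G" unfolding regular_at_def by blast
qed

lemma
  assumes "regular_at f G" "regular_at g G"
  shows subst_rat_add: "subst_rat (f + g) G = subst_rat f G + subst_rat g G"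
    and subst_rat_mult: "subst_rat (f * g) G = subst_rat f G * subst_rat g G"
    and regular_at_add: "regular_at (f + g) G"
    and regular_at_mult: "regular_at (f * g) G"
proof -
  obtain a b where f: "f = to_fract a / to_fract b" "b \<noteq> 0" "eval_poly3 b G \<noteq> 0"
    "subst_rat f G = eval_poly3 a G / eval_poly3 b G"
    using assms(1) by (rule regular_atE)
  obtain c d where g: "g = to_fract c / to_fract d" "d \<noteq> 0" "eval_poly3 d G \<noteq> 0"
    "subst_rat g G = eval_poly3 c G / eval_poly3 d G"
    using assms(2) by (rule regular_atE)
  have add: "f + g = to_fract (a * d + c * b) / to_fract (b * d)"
    using f g by (simp add: add_frac_eq)
  have mult: "f * g = to_fract (a * c) / to_fract (b * d)"
    using f g by simp
  show "subst_rat (f + g) G = subst_rat f G + subst_rat g G"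
    unfolding add using f(3,4) g(3,4) by (subst subst_rat_quotient) (simp_all add: add_frac_eq)
  show "subst_rat (f * g) G = subst_rat f G * subst_rat g G"
    unfolding mult using f(3,4) g(3,4) by (subst subst_rat_quotient) simp_all
  show "regular_at (f + g) G" "regular_at (f * g) G"
    unfolding add mult regular_at_def using f(3) g(3) by (metis eval_poly3_mult no_zero_divisors)+
qed

lemma
  assumes "regular_at f G" "subst_rat f G \<noteq> 0"
  shows subst_rat_inverse: "subst_rat (inverse f) G = inverse (subst_rat f G)"
    and regular_at_inverse: "regular_at (inverse f) G"
proof -
  obtain a b where f: "f = to_fract a / to_fract b" "b \<noteq> 0" "eval_poly3 b G \<noteq> 0"
    "subst_rat f G = eval_poly3 a G / eval_poly3 b G"
    using assms(1) by (rule regular_atE)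
  have a: "eval_poly3 a G \<noteq> 0" using assms(2) f by auto
  have inv: "inverse f = to_fract b / to_fract a" using f by simp
  show "subst_rat (inverse f) G = inverse (subst_rat f G)"
    unfolding inv using a f(4) by (subst subst_rat_quotient) simp_all
  show "regular_at (inverse f) G" unfolding inv regular_at_def using a by blast
qed

lemma
  assumes "regular_at f G" "regular_at g G" "subst_rat g G \<noteq> 0"
  shows subst_rat_divide: "subst_rat (f / g) G = subst_rat f G / subst_rat g G"
    and regular_at_divide: "regular_at (f / g) G"
  using assms by (simp_all add: divide_inverse subst_rat_mult regular_at_mult
      subst_rat_inverse regular_at_inverse)

lemma eval_poly3_uminus [simp]: "eval_poly3 (- p) G = - eval_poly3 p G"
  by (metis add.right_inverse add_eq_0_iff eval_poly3_0 eval_poly3_add)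

lemma
  assumes "regular_at f G"
  shows subst_rat_uminus: "subst_rat (- f) G = - subst_rat f G"
    and regular_at_uminus: "regular_at (- f) G"
  using subst_rat_mult[OF regular_at_to_fract[of "-1"] assms]
    regular_at_mult[OF regular_at_to_fract[of "-1"] assms] subst_rat_to_fract[of "-1" G]
  by simp_all

lemma
  assumes "regular_at f G" "regular_at g G"
  shows subst_rat_diff: "subst_rat (f - g) G = subst_rat f G - subst_rat g G"
    and regular_at_diff: "regular_at (f - g) G"
  using subst_rat_add[OF assms(1) regular_at_uminus[OF assms(2)]]
    regular_at_add[OF assms(1) regular_at_uminus[OF assms(2)]] subst_rat_uminus[OF assms(2)]
  by simp_all

lemma subst_rat_1 [simp]: "subst_rat 1 G = 1" and regular_at_1 [simp]: "regular_at 1 G"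
  using subst_rat_to_fract[of 1 G] regular_at_to_fract[of 1 G] by simp_all

lemma
  assumes "regular_at f G"
  shows subst_rat_power: "subst_rat (f ^ n) G = subst_rat f G ^ n"
    and regular_at_power: "regular_at (f ^ n) G"
proof -
  have "subst_rat (f ^ n) G = subst_rat f G ^ n \<and> regular_at (f ^ n) G"
    by (induction n) (simp_all add: assms subst_rat_mult regular_at_mult)
  thus "subst_rat (f ^ n) G = subst_rat f G ^ n" "regular_at (f ^ n) G" by simp_all
qed

lemma subst_rat_numeral [simp]: "subst_rat (numeral n) G = numeral n"
  and regular_at_numeral [simp]: "regular_at (numeral n) G"
proof -
  have "subst_rat (of_nat n) G = of_nat n \<and> regular_at (of_nat n) G" for n
    using subst_rat_to_fract[of 0 G] regular_at_to_fract[of 0 G]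
    by (induction n) (simp_all add: subst_rat_add regular_at_add)
  from this[of "numeral n"] show "subst_rat (numeral n) G = numeral n" "regular_at (numeral n) G"
    by simp_all
qed

lemma subst_rat_gens [simp]:
  "subst_rat rat_x (f, g, h) = f" "subst_rat rat_y (f, g, h) = g" "subst_rat rat_z (f, g, h) = h"
  "regular_at rat_x G" "regular_at rat_y G" "regular_at rat_z G"
  by (simp_all add: rat_x_def rat_y_def rat_z_def)

lemmas subst_rat_simps = subst_rat_add subst_rat_mult subst_rat_diff subst_rat_uminus
  subst_rat_power subst_rat_divide regular_at_add regular_at_mult regular_at_diff
  regular_at_uminus regular_at_power regular_at_divide

fun regular_map_at :: "ratmap3 \<Rightarrow> ratmap3 \<Rightarrow> bool" where
  "regular_map_at (f, g, h) G \<longleftrightarrow> regular_at f G \<and> regular_at g G \<and> regular_at h G"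

lemma
  assumes "regular_map_at F G"
  shows subst_rat_eval_poly3: "subst_rat (eval_poly3 p F) G = eval_poly3 p (comp_ratmap F G)"
    and regular_at_eval_poly3: "regular_at (eval_poly3 p F) G"
proof -
  obtain f g h where F: "F = (f, g, h)" by (cases F)
  have "subst_rat (eval_poly3 p F) G = eval_poly3 p (comp_ratmap F G) \<and> regular_at (eval_poly3 p F) G"
    using assms
    by (induction p rule: poly3_induct) (auto simp: F subst_rat_add subst_rat_mult regular_at_add regular_at_mult)
  thus "subst_rat (eval_poly3 p F) G = eval_poly3 p (comp_ratmap F G)" "regular_at (eval_poly3 p F) G"
    by auto
qed

section \<open>Dominant maps and the birational group\<close>

lemma dominant_regular_at: "dominant G \<Longrightarrow> regular_at f G"
  unfolding dominant_def regular_at_def by (rule ratfun_cases[of f]) blast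

lemma dominant_regular_map_at: "dominant G \<Longrightarrow> regular_map_at F G"
  by (cases F) (simp add: dominant_regular_at)

lemma subst_rat_eq_0_iff:
  assumes "dominant G"
  shows "subst_rat f G = 0 \<longleftrightarrow> f = 0"
proof -
  obtain a b where f: "f = to_fract a / to_fract b" "b \<noteq> 0" "eval_poly3 b G \<noteq> 0"
    "subst_rat f G = eval_poly3 a G / eval_poly3 b G"
    using dominant_regular_at[OF assms] by (rule regular_atE)
  thus ?thesis using assms by (auto simp: dominant_def)
qed

lemma dominant_comp_ratmap:
  assumes "dominant F" "dominant G"
  shows "dominant (comp_ratmap F G)"
  unfolding dominant_def
proof (intro allI impI)
  fix p :: poly3 assume "p \<noteq> 0"
  with assms show "eval_poly3 p (comp_ratmap F G) \<noteq> 0"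
    by (simp add: dominant_def subst_rat_eq_0_iff dominant_regular_map_at flip: subst_rat_eval_poly3)
qed

text \<open>Substituting \<open>G\<close> into a polynomial relation between the components of
  \<open>F\<close> gives the same relation between the variables themselves. Only regularity is
  assumed, so this is the entry point to dominance.\<close>

lemma dominant_if_comp_ratmap_eq_id:
  assumes "regular_map_at F G" "comp_ratmap F G = (rat_x, rat_y, rat_z)"
  shows "dominant F"
  unfolding dominant_def
proof (intro allI impI notI)
  fix p :: poly3 assume "p \<noteq> 0" "eval_poly3 p F = 0"
  with subst_rat_eval_poly3[OF assms(1), of p] subst_rat_to_fract[of 0 G] show False
    by (simp add: assms(2) eval_poly3_id)
qed

lemma subst_rat_subst_rat:
  assumes "dominant G" "dominant H"
  shows "subst_rat (subst_rat f G) H = subst_rat f (comp_ratmap G H)"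
proof -
  note dom = dominant_comp_ratmap[OF assms]
  obtain a b where f: "f = to_fract a / to_fract b" "b \<noteq> 0"
    by (rule ratfun_cases)
  have nz: "eval_poly3 b G \<noteq> 0" "eval_poly3 b (comp_ratmap G H) \<noteq> 0"
    using f assms dom by (auto simp: dominant_def)
  note reg = dominant_regular_map_at[OF assms(2), of G]
  show ?thesis
    unfolding f subst_rat_quotient[OF nz(1)] subst_rat_quotient[OF nz(2)]
    using nz reg by (simp add: subst_rat_divide regular_at_eval_poly3 subst_rat_eval_poly3)
qed

lemma subst_rat_id [simp]: "subst_rat f (rat_x, rat_y, rat_z) = f"
proof -
  obtain a b where f: "f = to_fract a / to_fract b" "b \<noteq> 0" by (rule ratfun_cases)
  show ?thesis unfolding f
    by (subst subst_rat_quotient) (use f in \<open>simp_all add: eval_poly3_id\<close>)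
qed

lemma monoid_dominant_ratmaps: "monoid dominant_ratmaps"
proof (rule monoidI)
  fix F G H assume "F \<in> carrier dominant_ratmaps" "G \<in> carrier dominant_ratmaps" "H \<in> carrier dominant_ratmaps"
  thus "F \<otimes>\<^bsub>dominant_ratmaps\<^esub> G \<otimes>\<^bsub>dominant_ratmaps\<^esub> H = F \<otimes>\<^bsub>dominant_ratmaps\<^esub> (G \<otimes>\<^bsub>dominant_ratmaps\<^esub> H)"
    by (cases F) (simp add: dominant_ratmaps_def subst_rat_subst_rat)
next
  fix F assume "F \<in> carrier dominant_ratmaps"
  show "\<one>\<^bsub>dominant_ratmaps\<^esub> \<otimes>\<^bsub>dominant_ratmaps\<^esub> F = F" "F \<otimes>\<^bsub>dominant_ratmaps\<^esub> \<one>\<^bsub>dominant_ratmaps\<^esub> = F"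
    by (cases F; simp add: dominant_ratmaps_def)+
next
  fix F G assume "F \<in> carrier dominant_ratmaps" "G \<in> carrier dominant_ratmaps"
  thus "F \<otimes>\<^bsub>dominant_ratmaps\<^esub> G \<in> carrier dominant_ratmaps"
    by (simp add: dominant_ratmaps_def dominant_comp_ratmap)
qed (auto simp: dominant_ratmaps_def dominant_def eval_poly3_id)

lemma group_birational: "group birational_group"
  unfolding birational_group_def
  by (rule monoid.units_group[OF monoid_dominant_ratmaps])

lemma birational_group_mult [simp]: "F \<otimes>\<^bsub>birational_group\<^esub> G = comp_ratmap F G"
  and birational_group_one [simp]: "\<one>\<^bsub>birational_group\<^esub> = (rat_x, rat_y, rat_z)"
  by (simp_all add: birational_group_def dominant_ratmaps_def units_of_def)

lemma mem_birational_groupI: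
  assumes "dominant F" "dominant G" "comp_ratmap F G = (rat_x, rat_y, rat_z)"
    "comp_ratmap G F = (rat_x, rat_y, rat_z)"
  shows "F \<in> carrier birational_group"
  using assms unfolding birational_group_def units_of_def Units_def dominant_ratmaps_def
  by (simp del: split_paired_Ex) blast

section \<open>The derivation \<open>W\<close>\<close>

definition derivation_on :: "('a::comm_ring_1 \<Rightarrow> 'a) \<Rightarrow> bool" where
  "derivation_on d \<longleftrightarrow> (\<forall>a b. d (a + b) = d a + d b) \<and> (\<forall>a b. d (a * b) = d a * b + a * d b)"

lemma derivation_on_0: "derivation_on d \<Longrightarrow> d 0 = 0"
  unfolding derivation_on_def by (metis add.right_neutral add_cancel_left_right)

text \<open>\<open>partial_x\<close> and \<open>partial_y\<close> differentiate the coefficients of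
  outer layers, so the Leibniz rule is transported through \<open>map_poly\<close>.\<close>

lemma derivation_on_map_poly:
  fixes d :: "'a::comm_ring_1 \<Rightarrow> 'a"
  assumes "derivation_on d"
  shows "derivation_on (map_poly d)"
proof -
  note d0 = derivation_on_0[OF assms]
  have d: "d (a + b) = d a + d b" "d (a * b) = d a * b + a * d b" for a b
    using assms by (auto simp: derivation_on_def)
  have add: "map_poly d (p + q) = map_poly d p + map_poly d q" for p q
    by (rule poly_eqI) (simp add: coeff_map_poly d d0)
  have smult: "map_poly d (Polynomial.smult c p) = Polynomial.smult (d c) p + Polynomial.smult c (map_poly d p)" for c p
    by (rule poly_eqI) (simp add: coeff_map_poly d d0)
  have "map_poly d (p * q) = map_poly d p * q + p * map_poly d q" for p q
    by (induction p) (simp_all add: map_poly_pCons d0 add smult algebra_simps)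
  with add show ?thesis by (simp add: derivation_on_def)
qed

lemma derivation_on_pderiv: "derivation_on (pderiv :: 'a::idom poly \<Rightarrow> _)"
  by (simp add: derivation_on_def pderiv_add pderiv_mult algebra_simps)

lemma derivation_on_W_poly: "derivation_on W_poly"
proof -
  have "derivation_on partial_x" "derivation_on partial_y" "derivation_on partial_z"
    unfolding partial_x_def partial_y_def partial_z_def
    by (intro derivation_on_map_poly derivation_on_pderiv)+
  thus ?thesis by (simp add: derivation_on_def W_poly_def algebra_simps)
qed

lemma W_poly_add [simp]: "W_poly (p + q) = W_poly p + W_poly q"
  and W_poly_mult [simp]: "W_poly (p * q) = W_poly p * q + p * W_poly q"
  using derivation_on_W_poly by (auto simp: derivation_on_def)

lemma W_poly_gens [simp]:
  "W_poly (const3 c) = 0" "W_poly poly_x = poly_y" "W_poly poly_y = poly_z"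
  "W_poly poly_z = chazy poly_x poly_y poly_z"
  by (simp_all add: W_poly_def partial_x_def partial_y_def partial_z_def const3_def
      poly_x_def poly_y_def poly_z_def map_poly_pCons pderiv_pCons chazy_def one_pCons)
    (simp flip: one_pCons)

lemma W_poly_1 [simp]: "W_poly 1 = 0"
  using W_poly_gens(1)[of 1] by (simp add: const3_def one_pCons)

lemma W_rat_quotient:
  assumes "b \<noteq> 0"
  shows "W_rat (to_fract a / to_fract b) =
    (to_fract (W_poly a) * to_fract b - to_fract a * to_fract (W_poly b)) / to_fract b ^ 2"
proof -
  obtain a0 b0 where q: "quot_of_fract (to_fract a / to_fract b) = (a0, b0)" by fastforce
  have "quot_of_fract (to_fract a / to_fract b) = normalize_quot (a, b)"
    using assms quot_of_fract_quot_to_fract[of "(a, b)"] by (simp add: quot_to_fract_def to_fract_def)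
  with normalize_quotE[OF assms, of a] q obtain d where d: "a = a0 * d" "b = b0 * d" "d \<noteq> 0"
    by (metis fst_conv snd_conv)
  have b0: "b0 \<noteq> 0" using assms d by auto
  have "W_rat (to_fract a / to_fract b) = Fraction_Field.Fract (W_poly a0 * b0 - a0 * W_poly b0) (b0^2)"
    by (simp add: W_rat_def q)
  \<comment> \<open>\<open>W_rat\<close> is defined on the reduced fraction. Restoring the common
    factor \<open>d\<close> multiplies both parts by \<open>d^2\<close>, since the terms with
    \<open>W_poly d\<close> cancel.\<close>
  also have "\<dots> = Fraction_Field.Fract (W_poly a * b - a * W_poly b) (b^2)"
    using b0 d(3) by (simp add: eq_fract d algebra_simps power2_eq_square)
  also have "\<dots> = (to_fract (W_poly a) * to_fract b - to_fract a * to_fract (W_poly b)) / to_fract b ^ 2"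
    using assms by (simp add: to_fract_def power2_eq_square)
  finally show ?thesis .
qed

lemma W_rat_to_fract: "W_rat (to_fract p) = to_fract (W_poly p)"
  using W_rat_quotient[of 1 p] by simp

lemma derivation_on_W_rat: "derivation_on W_rat"
  unfolding derivation_on_def
proof (intro conjI allI)
  fix f g :: ratfun3
  obtain a b where f: "f = to_fract a / to_fract b" "b \<noteq> 0" by (rule ratfun_cases)
  obtain c d where g: "g = to_fract c / to_fract d" "d \<noteq> 0" by (rule ratfun_cases)
  have add: "f + g = to_fract (a * d + c * b) / to_fract (b * d)"
    using f g by (simp add: add_frac_eq)
  have mult: "f * g = to_fract (a * c) / to_fract (b * d)"
    using f g by simp
  show "W_rat (f + g) = W_rat f + W_rat g"
    unfolding add unfolding f g using f(2) g(2)
    by (subst (1 2 3) W_rat_quotient) (simp_all add: field_simps power2_eq_square)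
  show "W_rat (f * g) = W_rat f * g + f * W_rat g"
    unfolding mult unfolding f g using f(2) g(2)
    by (subst (1 2 3) W_rat_quotient) (simp_all add: field_simps power2_eq_square)
qed

lemma W_rat_0 [simp]: "W_rat 0 = 0"
  by (rule derivation_on_0[OF derivation_on_W_rat])

lemma W_rat_add: "W_rat (f + g) = W_rat f + W_rat g"
  and W_rat_mult: "W_rat (f * g) = W_rat f * g + f * W_rat g"
  using derivation_on_W_rat by (auto simp: derivation_on_def)

lemma W_rat_uminus: "W_rat (- f) = - W_rat f"
  by (metis W_rat_0 W_rat_add add.right_inverse minus_unique)

lemma W_rat_diff: "W_rat (f - g) = W_rat f - W_rat g"
  using W_rat_add[of f "- g"] by (simp add: W_rat_uminus)

lemma W_rat_1 [simp]: "W_rat 1 = 0"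
  using W_rat_to_fract[of 1] by simp

lemma W_rat_numeral [simp]: "W_rat (numeral n) = 0"
proof -
  have "W_rat (of_nat k) = 0" for k by (induction k) (simp_all add: W_rat_add)
  from this[of "numeral n"] show ?thesis by simp
qed

lemma W_rat_divide:
  assumes "g \<noteq> 0"
  shows "W_rat (f / g) = (W_rat f - (f / g) * W_rat g) / g"
proof -
  have "W_rat f = W_rat (f / g) * g + (f / g) * W_rat g"
    using W_rat_mult[of "f / g" g] assms by simp
  thus ?thesis using assms by simp
qed

lemma to_fract_numeral [simp]: "to_fract (numeral n :: poly3) = numeral n"
proof -
  have "to_fract (of_nat k :: poly3) = of_nat k" for k by (induction k) simp_all
  from this[of "numeral n"] show ?thesis by simp
qed

lemma W_rat_gens [simp]:
  "W_rat rat_x = rat_y" "W_rat rat_y = rat_z" "W_rat rat_z = chazy rat_x rat_y rat_z"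
  by (simp_all add: rat_x_def rat_y_def rat_z_def W_rat_to_fract)
    (simp add: chazy_def power2_eq_square)

lemma eval_poly3_diff [simp]: "eval_poly3 (p - q) G = eval_poly3 p G - eval_poly3 q G"
  using eval_poly3_add[of p "- q"] by simp

lemma eval_poly3_numeral [simp]: "eval_poly3 (numeral n) G = numeral n"
proof -
  have "eval_poly3 (of_nat k) G = of_nat k" for k by (induction k) simp_all
  from this[of "numeral n"] show ?thesis by simp
qed

text \<open>
  These are the maps under which \<open>W\<close> is related to itself. Such a map is determined by its first
  component, so composites of the substitutions need to be compared in that component only.
\<close>

fun chazy_map :: "ratmap3 \<Rightarrow> bool" where
  "chazy_map (f, g, h) \<longleftrightarrow> W_rat f = g \<and> W_rat g = h \<and> W_rat h = chazy f g h"

text \<open>Chain rule. Both sides are additive and obey the same Leibniz rule in \<open>p\<close>,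
  and on the variables the claim is the definition of \<open>chazy_map\<close>.\<close>

lemma W_rat_eval_poly3:
  assumes "chazy_map F"
  shows "W_rat (eval_poly3 p F) = eval_poly3 (W_poly p) F"
proof -
  obtain f g h where F: "F = (f, g, h)" by (cases F)
  show ?thesis
    using assms unfolding F
    by (induction p rule: poly3_induct)
      (auto simp: W_rat_to_fract W_rat_add W_rat_mult chazy_def power2_eq_square)
qed

lemma
  assumes "chazy_map G" "regular_at f G"
  shows W_rat_subst_rat: "W_rat (subst_rat f G) = subst_rat (W_rat f) G"
    and regular_at_W_rat: "regular_at (W_rat f) G"
proof -
  obtain a b where f: "f = to_fract a / to_fract b" "b \<noteq> 0" "eval_poly3 b G \<noteq> 0"
    "subst_rat f G = eval_poly3 a G / eval_poly3 b G"
    using assms(2) by (rule regular_atE)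
  have W: "W_rat f = to_fract (W_poly a * b - a * W_poly b) / to_fract (b * b)"
    unfolding f W_rat_quotient[OF f(2)] by (simp add: power2_eq_square)
  have nz: "eval_poly3 (b * b) G \<noteq> 0" using f by simp
  show "W_rat (subst_rat f G) = subst_rat (W_rat f) G"
    unfolding f(4) W_rat_divide[OF f(3)] W subst_rat_quotient[OF nz]
    using f(3) by (simp add: W_rat_eval_poly3[OF assms(1)] field_simps)
  show "regular_at (W_rat f) G"
    unfolding W regular_at_def using nz by blast
qed

text \<open>Regularity has to be checked in the first component only: the others are its derivatives
  along \<open>W\<close>, and differentiation merely squares the denominator.\<close>

lemma
  assumes "chazy_map F" "chazy_map G" "regular_at (fst F) G"
  shows regular_map_at_chazy_map: "regular_map_at F G"
    and chazy_map_comp_ratmap: "chazy_map (comp_ratmap F G)"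
    and fst_comp_ratmap: "fst (comp_ratmap F G) = subst_rat (fst F) G"
proof -
  obtain f g h where F: "F = (f, g, h)" by (cases F)
  have W: "W_rat f = g" "W_rat g = h" "W_rat h = chazy f g h"
    using assms(1) by (auto simp: F)
  have reg: "regular_at f G" "regular_at g G" "regular_at h G"
    using assms(3) regular_at_W_rat[OF assms(2)] by (auto simp: F simp flip: W(1,2))
  have "subst_rat (chazy f g h) G = chazy (subst_rat f G) (subst_rat g G) (subst_rat h G)"
    using reg by (simp add: chazy_def subst_rat_simps)
  with reg show "regular_map_at F G" "chazy_map (comp_ratmap F G)"
      "fst (comp_ratmap F G) = subst_rat (fst F) G"
    by (simp_all add: F W_rat_subst_rat[OF assms(2)] W)
qed

lemma extend_subst_fst: "chazy_map F \<Longrightarrow> extend_subst (fst F) = F"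
  by (cases F) (simp add: extend_subst_def)

lemma chazy_map_eqI: "chazy_map F \<Longrightarrow> chazy_map G \<Longrightarrow> fst F = fst G \<Longrightarrow> F = G"
  using extend_subst_fst by metis

lemma chazy_map_id: "chazy_map (rat_x, rat_y, rat_z)"
  by simp

lemma rat_nonzero:
  assumes "poly (poly (poly p [:[:c:]:]) [:b:]) a \<noteq> 0"
  shows "to_fract p \<noteq> 0"
  using assms by auto

text \<open>Denominators and numerators met in the compositions. The fifth entry separates
  \<open>R1\<close> from the identity, the last is \<open>rat_y^2\<close> times
  \<open>R1'\<close>.\<close>

lemma rat_nonzeros:
  "rat_x \<noteq> 0" "rat_y \<noteq> 0"
  "rat_x^2 - rat_y \<noteq> 0"
  "rat_x^3 - 3 * rat_x * rat_y + rat_z \<noteq> 0"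
  "rat_x * rat_y - rat_z \<noteq> 0"
  "2 * rat_x * rat_y - rat_z \<noteq> 0"
  "rat_x^2 * rat_y - rat_x * rat_z + rat_y^2 \<noteq> 0"
  "3 * rat_x^2 * rat_y^2 + rat_z^2 - rat_y^3 - 3 * rat_x * rat_y * rat_z \<noteq> 0"
  \<comment> \<open>The three numbers are the values of \<open>z\<close>, \<open>y\<close>,
    \<open>x\<close>, in this order, at a point where the polynomial does not vanish.\<close>
  using rat_nonzero[of poly_x 0 0 1] rat_nonzero[of poly_y 0 1 0]
    rat_nonzero[of "poly_x^2 - poly_y" 0 1 0]
    rat_nonzero[of "poly_x^3 - 3 * poly_x * poly_y + poly_z" 1 0 0]
    rat_nonzero[of "poly_x * poly_y - poly_z" 1 0 0]
    rat_nonzero[of "2 * poly_x * poly_y - poly_z" 1 0 0]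
    rat_nonzero[of "poly_x^2 * poly_y - poly_x * poly_z + poly_y^2" 0 1 0]
    rat_nonzero[of "3 * poly_x^2 * poly_y^2 + poly_z^2 - poly_y^3 - 3 * poly_x * poly_y * poly_z" 1 0 0]
  by (simp_all add: rat_x_def rat_y_def rat_z_def poly_x_def poly_y_def poly_z_def power2_eq_square power3_eq_cube
     del: to_fract_eq_0_iff flip: to_fract_add to_fract_mult to_fract_diff to_fract_uminus to_fract_numeral)

section \<open>The two generators as explicit rational maps\<close>

definition T1 :: ratmap3 where
  "T1 = (R1 rat_x rat_y rat_z, R1' rat_x rat_y rat_z, R1'' rat_x rat_y rat_z)"

definition T2 :: ratmap3 where
  "T2 = (R2 rat_x rat_y rat_z, R2' rat_x rat_y rat_z, R2'' rat_x rat_y rat_z)"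

text \<open>The Riccati equation for \<open>w\<close>, now read in the function field, reduces the
  claim to identities in \<open>rat_x\<close>, \<open>rat_y\<close>, \<open>w\<close>. By
  \<open>extend_subst_fst\<close> it follows that \<open>T1\<close> is the extension of
  \<open>R1\<close>.\<close>

lemma chazy_map_T1: "chazy_map T1"
proof -
  define w where "w = rat_z / rat_y"
  have z: "rat_z = w * rat_y" using rat_nonzeros by (simp add: w_def)
  have w: "W_rat w = 3 * rat_x * w + 3 * rat_y - 3 * rat_x^2 - w^2"
    unfolding w_def W_rat_divide[OF rat_nonzeros(2)] W_rat_gens chazy_def
    using rat_nonzeros(2) by (simp add: divide_eq_eq, simp add: algebra_simps power2_eq_square)
  have 0: "R1 rat_x rat_y rat_z = 2 * rat_x - w"
    using rat_nonzeros(2) by (simp add: R1_def w_def field_simps)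
  have 1: "R1' rat_x rat_y rat_z = - rat_y - 3 * rat_x * w + 3 * rat_x^2 + w^2"
    by (simp add: R1'_def w_def)
  have 2: "R1'' rat_x rat_y rat_z = 6 * rat_x * rat_y - 4 * rat_z +
       (2 * w - 3 * rat_x) * (3 * rat_x * w + 3 * rat_y - 3 * rat_x^2 - w^2)"
    by (simp add: R1''_def w_def)
  note W = W_rat_add W_rat_mult W_rat_diff W_rat_uminus w power2_eq_square chazy_def z
  show ?thesis
    unfolding T1_def chazy_map.simps 0 1 2
    by (intro conjI; simp add: W; simp add: algebra_simps)
qed

lemma chazy_map_T2: "chazy_map T2"
proof -
  define p q where "p = rat_y / rat_x" and "q = rat_z / rat_x"
  have yz: "rat_y = p * rat_x" "rat_z = q * rat_x" using rat_nonzeros by (simp_all add: p_def q_def)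
  have p: "W_rat p = q - p^2"
    unfolding p_def q_def W_rat_divide[OF rat_nonzeros(1)] W_rat_gens
    using rat_nonzeros(1) by (simp add: divide_eq_eq, simp add: algebra_simps power2_eq_square)
  have q: "W_rat q = 3 * q * rat_x + 3 * p^2 * rat_x - 3 * p * rat_x^2 - q * p"
    unfolding q_def W_rat_divide[OF rat_nonzeros(1)] W_rat_gens chazy_def
    using rat_nonzeros(1) by (simp add: divide_eq_eq yz, simp add: algebra_simps power2_eq_square)
  have 0: "R2 rat_x rat_y rat_z = rat_x - p"
    using rat_nonzeros(1) by (simp add: R2_def p_def field_simps power2_eq_square)
  have 1: "R2' rat_x rat_y rat_z = rat_y - q + p^2"
    by (simp add: R2'_def p_def q_def)
  have 2: "R2'' rat_x rat_y rat_z =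
      - 2 * rat_z - 3 * p * rat_y + 3 * rat_x * rat_y + 3 * p * q - 2 * p^3"
    by (simp add: R2''_def p_def q_def)
  note W = W_rat_add W_rat_mult W_rat_diff W_rat_uminus p q power2_eq_square power3_eq_cube chazy_def
  show ?thesis
    unfolding T2_def chazy_map.simps 0 1 2
    by (intro conjI; simp add: W; simp add: algebra_simps yz)
qed

lemma
  assumes "g \<noteq> 0"
  shows subst_rat_R1: "subst_rat (R1 rat_x rat_y rat_z) (f, g, h) = R1 f g h"
    and regular_at_R1: "regular_at (R1 rat_x rat_y rat_z) (f, g, h)"
  using assms by (simp_all add: R1_def subst_rat_simps)

lemma
  assumes "f \<noteq> 0"
  shows subst_rat_R2: "subst_rat (R2 rat_x rat_y rat_z) (f, g, h) = R2 f g h"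
    and regular_at_R2: "regular_at (R2 rat_x rat_y rat_z) (f, g, h)"
  using assms by (simp_all add: R2_def subst_rat_simps)

lemma
  assumes "f^2 - g \<noteq> 0"
  shows subst_rat_R3: "subst_rat (R3 rat_x rat_y rat_z) (f, g, h) = R3 f g h"
    and regular_at_R3: "regular_at (R3 rat_x rat_y rat_z) (f, g, h)"
  using assms by (simp_all add: R3_def subst_rat_simps)

text \<open>The third application of \<open>R2\<close> closes the cycle. As
  \<open>R2 r r' h = r - r'/r\<close>, only the logarithmic derivative of \<open>R3 = c / v\<close>
  is required.\<close>

lemma R2_R3:
  "R2 (R3 rat_x rat_y rat_z) (W_rat (R3 rat_x rat_y rat_z)) h = rat_x"
proof -
  define c where "c = rat_x^3 - 3 * rat_x * rat_y + rat_z"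
  define v where "v = rat_x^2 - rat_y"
  have nz: "c \<noteq> 0" "v \<noteq> 0" using rat_nonzeros by (simp_all add: c_def v_def)
  have W: "W_rat c = 0" "W_rat v = 2 * rat_x * rat_y - rat_z"
    by (simp_all add: c_def v_def power2_eq_square power3_eq_cube W_rat_add W_rat_diff W_rat_mult
        chazy_def algebra_simps)
  \<comment> \<open>\<open>c\<close> is a first integral, so only the denominator
    contributes.\<close>
  have Wcv: "W_rat (c / v) = - (c / v) * ((2 * rat_x * rat_y - rat_z) / v)"
    unfolding W_rat_divide[OF nz(2)] W by simp
  have R2: "R2 r (- r * s) h = r + s" if "r \<noteq> 0" for r s :: ratfun3
    using that by (simp add: R2_def power2_eq_square add_divide_distrib)
  have "R2 (c / v) (W_rat (c / v)) h = c / v + (2 * rat_x * rat_y - rat_z) / v"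
    unfolding Wcv by (rule R2) (use nz in simp)
  also have "\<dots> = (c + (2 * rat_x * rat_y - rat_z)) / v"
    by (rule add_divide_distrib[symmetric])
  also have "c + (2 * rat_x * rat_y - rat_z) = rat_x * v"
    by (simp add: c_def v_def algebra_simps power2_eq_square power3_eq_cube)
  finally show ?thesis using nz by (simp add: R3_def c_def v_def)
qed

section \<open>Presentation of \<open>S\<^sub>3\<close>\<close>

text \<open>The pair \<open>(i, j)\<close> stands for the normal form \<open>b\<^sup>i a\<^sup>j\<close> of an element of
  \<open>\<langle>a, b | a\<^sup>2 = b\<^sup>3 = 1, a b = b\<^sup>2 a\<rangle>\<close>.\<close>

definition s3_indices :: "(nat \<times> nat) set" where
  "s3_indices = {..<3} \<times> {..<2}"

definition s3_index_mult :: "nat \<times> nat \<Rightarrow> nat \<times> nat \<Rightarrow> nat \<times> nat" where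
  "s3_index_mult = (\<lambda>(i, j) (k, l). ((i + (if j = 0 then k else 2 * k)) mod 3, (j + l) mod 2))"

lemma s3_indices_eq: "s3_indices = {(0,0), (1,0), (2,0), (0,1), (1,1), (2,1)}"
  unfolding s3_indices_def by (auto simp: less_Suc_eq numeral_eq_Suc)

lemma s3_index_mult_closed: "s3_index_mult p q \<in> s3_indices"
  by (auto simp: s3_indices_def s3_index_mult_def split: prod.splits)

lemma s3_index_inverse: "p \<in> s3_indices \<Longrightarrow> \<exists>q\<in>s3_indices. s3_index_mult p q = (0, 0)"
  by (auto simp: s3_indices_eq s3_index_mult_def)

text \<open>The presentation together with nontriviality of \<open>a\<close> and \<open>b\<close>.
  This excludes any collapse: the orders 2 and 3 are prime, and \<open>b_pow_neq\<close> separates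
  the two cosets of the powers of \<open>b\<close>.\<close>

locale s3_generators = group G for G (structure) +
  fixes a b
  assumes a [simp]: "a \<in> carrier G" and b [simp]: "b \<in> carrier G"
    and a_neq: "a \<noteq> \<one>" and b_neq: "b \<noteq> \<one>"
    and aa: "a \<otimes> a = \<one>" and bbb: "b \<otimes> (b \<otimes> b) = \<one>"
    and ab: "a \<otimes> b = (b \<otimes> b) \<otimes> a"
begin

definition elt :: "nat \<times> nat \<Rightarrow> 'a" where
  "elt = (\<lambda>(i, j). b [^] i \<otimes> a [^] j)"

lemma elt_closed: "elt p \<in> carrier G"
  by (auto simp: elt_def split: prod.splits)

lemma ord_a: "ord a = 2"
proof -
  have "ord a dvd 2"
    using aa by (simp flip: pow_eq_id add: eval_nat_numeral)
  moreover have "ord a \<noteq> 1" using a_neq ord_eq_1 by simp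
  ultimately show ?thesis using two_is_prime_nat by (metis prime_nat_iff)
qed

lemma ord_b: "ord b = 3"
proof -
  have "ord b dvd 3"
    using bbb by (simp flip: pow_eq_id add: eval_nat_numeral m_assoc)
  moreover have "ord b \<noteq> 1" using b_neq ord_eq_1 by simp
  moreover have "prime (3::nat)" by simp
  ultimately show ?thesis by (metis prime_nat_iff)
qed

lemma pow_mod_ord: "x [^] (n mod ord x) = x [^] (n::nat)" if x: "x \<in> carrier G"
proof -
  have "x [^] n = x [^] (n mod ord x + ord x * (n div ord x))" by simp
  also have "\<dots> = x [^] (n mod ord x) \<otimes> (x [^] ord x) [^] (n div ord x)"
    using x by (simp only: nat_pow_mult nat_pow_pow)
  finally show ?thesis using x by simp
qed

lemma a_b_pow: "a \<otimes> b [^] (n::nat) = b [^] (2 * n) \<otimes> a"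
proof (induction n)
  case (Suc n)
  have "a \<otimes> b [^] Suc n = (a \<otimes> b [^] n) \<otimes> b" by (simp add: m_assoc)
  also have "\<dots> = b [^] (2 * n) \<otimes> (a \<otimes> b)" by (simp add: Suc m_assoc)
  also have "\<dots> = b [^] (2 * Suc n) \<otimes> a" by (simp add: ab m_assoc)
  finally show ?case .
qed auto

lemma elt_mult:
  assumes "p \<in> s3_indices" "q \<in> s3_indices"
  shows "elt p \<otimes> elt q = elt (s3_index_mult p q)"
proof -
  obtain i j k l where p: "p = (i, j)" and q: "q = (k, l)" by (cases p, cases q)
  define m where "m = (if j = 0 then k else 2 * k)"
  have *: "a [^] j \<otimes> b [^] k = b [^] m \<otimes> a [^] j"
    using assms(1) a_b_pow by (cases "j = 0") (auto simp: p s3_indices_eq m_def)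
  have "elt p \<otimes> elt q = b [^] i \<otimes> (a [^] j \<otimes> b [^] k) \<otimes> a [^] l"
    by (simp add: p q elt_def m_assoc)
  also have "\<dots> = b [^] (i + m) \<otimes> a [^] (j + l)"
    unfolding * by (simp add: m_assoc flip: nat_pow_mult)
  also have "\<dots> = elt (s3_index_mult p q)"
    using pow_mod_ord[OF a, of "j + l"] pow_mod_ord[OF b, of "i + m"]
    by (simp add: ord_a ord_b elt_def s3_index_mult_def p q m_def)
  finally show ?thesis .
qed

text \<open>Otherwise \<open>b [^] k \<otimes> a\<close> would commute with \<open>b\<close>, hence
  so would \<open>a\<close>, and the relation \<open>ab\<close> would force \<open>b\<close> to be
  trivial.\<close>

lemma b_pow_neq: "b [^] (i::nat) \<noteq> b [^] (k::nat) \<otimes> a"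
proof
  assume *: "b [^] i = b [^] k \<otimes> a"
  have "(b [^] k \<otimes> a) \<otimes> b = b \<otimes> (b [^] k \<otimes> a)"
    unfolding *[symmetric] using nat_pow_Suc2[OF b, of i] by simp
  moreover have "b \<otimes> (b [^] k \<otimes> a) = b [^] k \<otimes> (b \<otimes> a)"
    using nat_pow_Suc2[OF b, of k] by (simp flip: m_assoc)
  ultimately have "a \<otimes> b = b \<otimes> a" by (simp add: m_assoc)
  with ab have "b \<otimes> (b \<otimes> a) = b \<otimes> a" by (simp add: m_assoc)
  hence "b \<otimes> a = a" by simp
  thus False using b_neq by (metis a b r_cancel_one)
qed

lemma elt_inj: "inj_on elt s3_indices"
proof (rule inj_onI)
  fix p q assume p: "p \<in> s3_indices" and q: "q \<in> s3_indices" and eq: "elt p = elt q"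
  have b_inj: "i = k" if "b [^] i = b [^] k" "i < 3" "k < 3" for i k :: nat
    using inj_onD[OF ord_inj[OF b] that(1)] that by (simp add: ord_b)
  show "p = q"
    using p q eq b_pow_neq b_pow_neq[symmetric] b_inj
    by (auto simp: s3_indices_def elt_def less_2_cases_iff)
qed

lemma carrier_generated: "carrier (subgroup_generated G {a, b}) = elt ` s3_indices"
proof
  have "subgroup (elt ` s3_indices) G"
  proof (rule subgroupI)
    fix x assume "x \<in> elt ` s3_indices"
    then obtain p where p: "p \<in> s3_indices" "x = elt p" by blast
    obtain q where q: "q \<in> s3_indices" "s3_index_mult p q = (0, 0)"
      using s3_index_inverse[OF p(1)] by blast
    have "elt p \<otimes> elt q = \<one>"
      using elt_mult[OF p(1) q(1)] q(2) by (simp add: elt_def)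
    hence "inv x = elt q"
      using elt_closed p(2) inv_unique' inv_equality by (metis inv_comm)
    with q show "inv x \<in> elt ` s3_indices" by blast
  next
    fix x y assume "x \<in> elt ` s3_indices" "y \<in> elt ` s3_indices"
    thus "x \<otimes> y \<in> elt ` s3_indices"
      using elt_mult s3_index_mult_closed by auto
  next
    show "elt ` s3_indices \<noteq> {}" by (simp add: s3_indices_eq)
  qed (use elt_closed in blast)
  moreover have "a = elt (0, 1)" "b = elt (1, 0)"
    by (simp_all add: elt_def)
  hence "{a, b} \<subseteq> elt ` s3_indices"
    by (auto simp: s3_indices_eq)
  ultimately show "carrier (subgroup_generated G {a, b}) \<subseteq> elt ` s3_indices"
    by (rule subgroup_generated_minimal)
  interpret H: group "subgroup_generated G {a, b}" by simp
  have "{a, b} \<subseteq> carrier (subgroup_generated G {a, b})"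
    by (rule subgroup_generated_subset_carrier_subset) simp
  hence "b [^]\<^bsub>subgroup_generated G {a, b}\<^esub> i \<otimes>\<^bsub>subgroup_generated G {a, b}\<^esub> a [^]\<^bsub>subgroup_generated G {a, b}\<^esub> j
       \<in> carrier (subgroup_generated G {a, b})" for i j :: nat
    by (intro H.m_closed H.nat_pow_closed) auto
  thus "elt ` s3_indices \<subseteq> carrier (subgroup_generated G {a, b})"
    by (auto simp: elt_def pow_subgroup_generated)
qed

lemma bij_elt: "bij_betw elt s3_indices (carrier (subgroup_generated G {a, b}))"
  using elt_inj by (simp add: bij_betw_def carrier_generated)

end

text \<open>In both groups the normal forms are distinct and multiply by the same table
  \<open>s3_index_mult\<close>, so matching them is an isomorphism.\<close>

lemma s3_generators_iso:
  assumes "s3_generators G a b" "s3_generators H c d"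
  shows "subgroup_generated G {a, b} \<cong> subgroup_generated H {c, d}"
proof -
  interpret G: s3_generators G a b by fact
  interpret H: s3_generators H c d by fact
  define f where "f = H.elt \<circ> the_inv_into s3_indices G.elt"
  have f: "f (G.elt p) = H.elt p" if "p \<in> s3_indices" for p
    using the_inv_into_f_f[OF G.elt_inj that] by (simp add: f_def)
  have "bij_betw f (carrier (subgroup_generated G {a, b})) (carrier (subgroup_generated H {c, d}))"
    unfolding f_def
    using bij_betw_trans[OF bij_betw_the_inv_into[OF G.bij_elt] H.bij_elt] .
  moreover have "f \<in> hom (subgroup_generated G {a, b}) (subgroup_generated H {c, d})"
  proof (rule homI)
    fix x y assume "x \<in> carrier (subgroup_generated G {a, b})" "y \<in> carrier (subgroup_generated G {a, b})"
    then obtain p q where p: "p \<in> s3_indices" "x = G.elt p" and q: "q \<in> s3_indices" "y = G.elt q"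
      unfolding G.carrier_generated by blast
    show "f (x \<otimes>\<^bsub>subgroup_generated G {a, b}\<^esub> y) = f x \<otimes>\<^bsub>subgroup_generated H {c, d}\<^esub> f y"
      using p q by (simp add: f s3_index_mult_closed G.elt_mult H.elt_mult)
  qed (auto simp: G.carrier_generated H.carrier_generated f)
  ultimately show ?thesis
    by (auto simp: is_iso_def iso_def)
qed

text \<open>A model of the presentation: a transposition and a 3-cycle, written as a product of
  adjacent transpositions.\<close>

lemma s3_generators_sym_group:
  "s3_generators (sym_group 3) (Transposition.transpose 1 2) (Transposition.transpose 1 2 \<circ> Transposition.transpose 2 (3::nat))"
proof -
  have mult: "(\<otimes>\<^bsub>sym_group 3\<^esub>) = (\<circ>)" "\<one>\<^bsub>sym_group 3\<^esub> = id"
    by (simp_all add: sym_group_def)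
  have t: "Transposition.transpose 1 2 permutes {1..3::nat}" "Transposition.transpose 2 3 permutes {1..3::nat}"
    by (auto intro: permutes_swap_id)
  interpret group "sym_group 3" by (rule sym_group_is_group)
  have neq: "Transposition.transpose 1 2 \<noteq> (id :: nat \<Rightarrow> nat)" "Transposition.transpose 1 2 \<circ> Transposition.transpose 2 3 \<noteq> (id :: nat \<Rightarrow> nat)"
    by (auto simp: fun_eq_iff Transposition.transpose_def intro: exI[of _ 1] exI[of _ 3])
  show ?thesis
    by unfold_locales
      (use t neq in \<open>auto simp: mult sym_group_carrier permutes_compose fun_eq_iff Transposition.transpose_def\<close>)
qed

text \<open>The model generates the whole symmetric group by counting: there are six normal forms
  and \<open>3! = 6\<close> permutations.\<close>

theorem s3_generators_iso_sym_group:
  assumes "s3_generators G a b"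
  shows "subgroup_generated G {a, b} \<cong> sym_group 3"
proof -
  define c d :: "nat \<Rightarrow> nat" where "c = Transposition.transpose 1 2" and "d = Transposition.transpose 1 2 \<circ> Transposition.transpose 2 3"
  interpret S: s3_generators "sym_group 3" c d
    unfolding c_def d_def by (rule s3_generators_sym_group)
  have "carrier (subgroup_generated (sym_group 3) {c, d}) = carrier (sym_group 3)"
  proof (rule card_subset_eq)
    show "finite (carrier (sym_group 3))"
      by (simp add: sym_group_def finite_permutations)
    have "card (carrier (subgroup_generated (sym_group 3) {c, d})) = 6"
      using bij_betw_same_card[OF S.bij_elt] by (simp add: s3_indices_def)
    moreover have "card (carrier (sym_group 3)) = 6"
      by (simp add: sym_group_def card_permutations[of _ 3] fact_numeral)
    ultimately show "card (carrier (subgroup_generated (sym_group 3) {c, d})) = card (carrier (sym_group 3))"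
      by simp
  qed (rule S.carrier_subgroup_generated_subset)
  hence "subgroup_generated (sym_group 3) {c, d} = sym_group 3"
    by (simp add: subgroup_generated_def sym_group_def)
  with s3_generators_iso[OF assms S.s3_generators_axioms] show ?thesis by simp
qed

section \<open>The group generated by the first two substitutions\<close>

text \<open>Taken as a square, so that its dominance follows from that of \<open>T2\<close>;
  \<open>T3_eq\<close> identifies it with the third substitution.\<close>

definition T3 :: ratmap3 where
  "T3 = comp_ratmap T2 T2"

lemma R1'_rat_nonzero: "R1' rat_x rat_y rat_z \<noteq> 0"
proof -
  have "R1' rat_x rat_y rat_z * rat_y^2 =
      3 * rat_x^2 * rat_y^2 + rat_z^2 - rat_y^3 - 3 * rat_x * rat_y * rat_z"
    using rat_nonzeros(2) by (simp add: R1'_def field_simps power2_eq_square power3_eq_cube)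
  thus ?thesis using rat_nonzeros(8) by auto
qed

lemma R1_rat_nonzero: "R1 rat_x rat_y rat_z \<noteq> 0"
  and R2_rat_nonzero: "R2 rat_x rat_y rat_z \<noteq> 0"
  and R3_rat_nonzero: "R3 rat_x rat_y rat_z \<noteq> 0"
  using rat_nonzeros by (simp_all add: R1_def R2_def R3_def)

lemma R2'_rat_nonzero: "R2' rat_x rat_y rat_z \<noteq> 0"
  using rat_nonzeros(1,7) by (simp add: R2'_eq algebra_simps)

lemma T1_T1: "comp_ratmap T1 T1 = (rat_x, rat_y, rat_z)"
  and regular_T1_T1: "regular_map_at T1 T1"
proof -
  have reg: "regular_at (fst T1) T1"
    unfolding T1_def fst_conv by (rule regular_at_R1[OF R1'_rat_nonzero])
  note comp = chazy_map_T1 chazy_map_T1 reg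
  show "regular_map_at T1 T1" by (rule regular_map_at_chazy_map[OF comp])
  show "comp_ratmap T1 T1 = (rat_x, rat_y, rat_z)"
  proof (rule chazy_map_eqI[OF chazy_map_comp_ratmap[OF comp] chazy_map_id])
    show "fst (comp_ratmap T1 T1) = fst (rat_x, rat_y, rat_z)"
      unfolding fst_comp_ratmap[OF comp] using rat_nonzeros(2) R1'_rat_nonzero
      by (simp add: T1_def subst_rat_R1 R1_R1)
  qed
qed

lemma dominant_T1: "dominant T1"
  by (rule dominant_if_comp_ratmap_eq_id[OF regular_T1_T1 T1_T1])

lemma chazy_map_T3: "chazy_map T3"
  and T3_eq: "T3 = extend_subst (R3 rat_x rat_y rat_z)"
proof -
  have reg: "regular_at (fst T2) T2"
    unfolding T2_def fst_conv by (rule regular_at_R2[OF R2_rat_nonzero])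
  note comp = chazy_map_T2 chazy_map_T2 reg
  show T3: "chazy_map T3"
    unfolding T3_def by (rule chazy_map_comp_ratmap[OF comp])
  have "fst T3 = R3 rat_x rat_y rat_z"
    unfolding T3_def fst_comp_ratmap[OF comp] using R2_rat_nonzero rat_nonzeros(1)
    by (simp add: T2_def subst_rat_R2 R2_R2)
  with extend_subst_fst[OF T3] show "T3 = extend_subst (R3 rat_x rat_y rat_z)" by simp
qed

text \<open>The cube of \<open>T2\<close> is bracketed with \<open>T2\<close> outside: regularity
  then amounts to \<open>R3\<close> being nonzero, and the result makes the outer map
  \<open>T2\<close> dominant.\<close>

lemma T2_T3: "comp_ratmap T2 T3 = (rat_x, rat_y, rat_z)"
  and regular_T2_T3: "regular_map_at T2 T3"
proof -
  have reg: "regular_at (fst T2) T3"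
    unfolding T2_def fst_conv T3_eq extend_subst_def by (rule regular_at_R2[OF R3_rat_nonzero])
  note comp = chazy_map_T2 chazy_map_T3 reg
  show "regular_map_at T2 T3" by (rule regular_map_at_chazy_map[OF comp])
  show "comp_ratmap T2 T3 = (rat_x, rat_y, rat_z)"
  proof (rule chazy_map_eqI[OF chazy_map_comp_ratmap[OF comp] chazy_map_id])
    show "fst (comp_ratmap T2 T3) = fst (rat_x, rat_y, rat_z)"
      unfolding fst_comp_ratmap[OF comp]
      using R3_rat_nonzero R2_R3
      by (simp add: T2_def T3_eq extend_subst_def subst_rat_R2)
  qed
qed

lemma dominant_T2: "dominant T2"
  by (rule dominant_if_comp_ratmap_eq_id[OF regular_T2_T3 T2_T3])

lemma dominant_T3: "dominant T3"
  unfolding T3_def by (intro dominant_comp_ratmap dominant_T2)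

text \<open>With \<open>T2\<close> known to be dominant, associativity is available and gives the
  other bracketing.\<close>

lemma T3_T2: "comp_ratmap T3 T2 = (rat_x, rat_y, rat_z)"
proof -
  have "comp_ratmap T3 T2 = comp_ratmap T2 T3"
    using monoid.m_assoc[OF monoid_dominant_ratmaps, of T2 T2 T2] dominant_T2
    by (simp add: dominant_ratmaps_def T3_def)
  thus ?thesis by (simp add: T2_T3)
qed

lemma extend_subst_R1: "extend_subst (R1 rat_x rat_y rat_z) = T1"
  and extend_subst_R2: "extend_subst (R2 rat_x rat_y rat_z) = T2"
  using extend_subst_fst[OF chazy_map_T1] extend_subst_fst[OF chazy_map_T2]
  by (simp_all add: T1_def T2_def)

lemma T1_T2: "comp_ratmap T1 T2 = extend_subst (R4 rat_x rat_y rat_z)"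
proof -
  have reg: "regular_at (fst T1) T2"
    unfolding T1_def fst_conv T2_def by (rule regular_at_R1[OF R2'_rat_nonzero])
  note comp = chazy_map_T1 chazy_map_T2 reg
  have "fst (comp_ratmap T1 T2) = R4 rat_x rat_y rat_z"
    unfolding fst_comp_ratmap[OF comp] using R2'_rat_nonzero rat_nonzeros(1)
    by (simp add: T1_def T2_def subst_rat_R1 R1_R2)
  with extend_subst_fst[OF chazy_map_comp_ratmap[OF comp]] show ?thesis by simp
qed

lemma T2_T1: "comp_ratmap T2 T1 = extend_subst (R5 rat_x rat_y rat_z)"
proof -
  have reg: "regular_at (fst T2) T1"
    unfolding T1_def fst_conv T2_def by (rule regular_at_R2[OF R1_rat_nonzero])
  note comp = chazy_map_T2 chazy_map_T1 reg
  have "fst (comp_ratmap T2 T1) = R5 rat_x rat_y rat_z"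
    unfolding fst_comp_ratmap[OF comp] using R1_rat_nonzero rat_nonzeros(2)
    by (simp add: T1_def T2_def subst_rat_R2 R2_R1)
  with extend_subst_fst[OF chazy_map_comp_ratmap[OF comp]] show ?thesis by simp
qed

lemma T3_T1: "comp_ratmap T3 T1 = extend_subst (R4 rat_x rat_y rat_z)"
proof -
  \<comment> \<open>The denominator of \<open>R3\<close> at \<open>T1\<close> is the numerator of
    \<open>R2\<close> at \<open>T1\<close>, and the latter composite is the nonzero function
    \<open>R5\<close>.\<close>
  have "R2 (R1 rat_x rat_y rat_z) (R1' rat_x rat_y rat_z) 0 \<noteq> 0"
    using rat_nonzeros(2,6,7) by (simp add: R2_R1 R5_def)
  hence nz: "R1 rat_x rat_y rat_z ^ 2 - R1' rat_x rat_y rat_z \<noteq> 0"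
    by (auto simp: R2_def)
  have reg: "regular_at (fst T3) T1"
    unfolding T3_eq extend_subst_def fst_conv T1_def by (rule regular_at_R3[OF nz])
  note comp = chazy_map_T3 chazy_map_T1 reg
  have "fst (comp_ratmap T3 T1) = R4 rat_x rat_y rat_z"
    unfolding fst_comp_ratmap[OF comp] using nz rat_nonzeros(2)
    by (simp add: T3_eq extend_subst_def T1_def subst_rat_R3 R3_R1)
  with extend_subst_fst[OF chazy_map_comp_ratmap[OF comp]] show ?thesis by simp
qed

lemma s3_generators_T1_T2: "s3_generators birational_group T1 T2"
proof -
  have "R1 rat_x rat_y rat_z \<noteq> rat_x" "R2 rat_x rat_y rat_z \<noteq> rat_x"
    using rat_nonzeros by (auto simp: R1_def R2_def divide_eq_eq power2_eq_square algebra_simps)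
  hence neq: "T1 \<noteq> (rat_x, rat_y, rat_z)" "T2 \<noteq> (rat_x, rat_y, rat_z)"
    by (simp_all add: T1_def T2_def)
  interpret group birational_group by (rule group_birational)
  show ?thesis
    by unfold_locales
      (use neq T1_T1 T2_T3 T1_T2 T3_T1
        mem_birational_groupI[OF dominant_T1 dominant_T1 T1_T1 T1_T1]
        mem_birational_groupI[OF dominant_T2 dominant_T3 T2_T3 T3_T2]
        in \<open>simp_all flip: T3_def\<close>)
qed

theorem theorem6:
  shows
    "(\<forall>U x. chazy_IV_solution U x \<longrightarrow>
       (let x' = deriv x; x'' = (deriv ^^ 2) x in
         (nonvanishing_along U x (\<lambda>t. x' t) \<longrightarrow>
            chazy_IV_solution U (\<lambda>t. R1 (x t) (x' t) (x'' t))) \<and>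
         (nonvanishing_along U x (\<lambda>t. x t) \<longrightarrow>
            chazy_IV_solution U (\<lambda>t. R2 (x t) (x' t) (x'' t))) \<and>
         (nonvanishing_along U x (\<lambda>t. (x t)^2 - x' t) \<longrightarrow>
            chazy_IV_solution U (\<lambda>t. R3 (x t) (x' t) (x'' t))) \<and>
         (nonvanishing_along U x (\<lambda>t. (x t)^2 * x' t + (x' t)^2 - x t * x'' t) \<longrightarrow>
            chazy_IV_solution U (\<lambda>t. R4 (x t) (x' t) (x'' t))) \<and>
         (nonvanishing_along U x (\<lambda>t. 2 * x t * x' t - x'' t) \<longrightarrow>
            chazy_IV_solution U (\<lambda>t. R5 (x t) (x' t) (x'' t))))) \<and>
     (let T1 = extend_subst (R1 rat_x rat_y rat_z);
          T2 = extend_subst (R2 rat_x rat_y rat_z);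
          T3 = extend_subst (R3 rat_x rat_y rat_z);
          T4 = extend_subst (R4 rat_x rat_y rat_z);
          T5 = extend_subst (R5 rat_x rat_y rat_z);
          H = subgroup_generated birational_group {T1, T2}
      in T1 \<in> carrier birational_group \<and> T2 \<in> carrier birational_group \<and>
         group.ord birational_group T1 = 2 \<and>
         group.ord birational_group T2 = 3 \<and>
         H \<cong> sym_group 3 \<and>
         {T3, T4, T5} \<subseteq> carrier H)"
  unfolding Let_def
proof (intro conjI allI impI)
  fix U x assume x: "chazy_IV_solution U x"
  note sol = chazy_IV_substitutions[OF x]
  show "chazy_IV_solution U (\<lambda>t. R1 (x t) (deriv x t) ((deriv ^^ 2) x t))"
    if "nonvanishing_along U x (\<lambda>t. deriv x t)" using sol(1) that .
  show "chazy_IV_solution U (\<lambda>t. R2 (x t) (deriv x t) ((deriv ^^ 2) x t))"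
    if "nonvanishing_along U x (\<lambda>t. x t)" using sol(2) that .
  show "chazy_IV_solution U (\<lambda>t. R3 (x t) (deriv x t) ((deriv ^^ 2) x t))"
    if "nonvanishing_along U x (\<lambda>t. (x t)^2 - deriv x t)" using sol(3) that .
  show "chazy_IV_solution U (\<lambda>t. R4 (x t) (deriv x t) ((deriv ^^ 2) x t))"
    if "nonvanishing_along U x (\<lambda>t. (x t)^2 * deriv x t + (deriv x t)^2 - x t * (deriv ^^ 2) x t)"
    using sol(4) that .
  show "chazy_IV_solution U (\<lambda>t. R5 (x t) (deriv x t) ((deriv ^^ 2) x t))"
    if "nonvanishing_along U x (\<lambda>t. 2 * x t * deriv x t - (deriv ^^ 2) x t)"
    using sol(5) that .
next
  interpret s3_generators birational_group T1 T2 by (rule s3_generators_T1_T2)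
  let ?H = "subgroup_generated birational_group {T1, T2}"
  interpret H: group ?H by simp
  have gen: "{T1, T2} \<subseteq> carrier ?H"
    by (rule subgroup_generated_subset_carrier_subset) simp
  have "{comp_ratmap T2 T2, comp_ratmap T1 T2, comp_ratmap T2 T1} \<subseteq> carrier ?H"
    using gen H.m_closed[of T2 T2] H.m_closed[of T1 T2] H.m_closed[of T2 T1] by simp
  thus "{extend_subst (R3 rat_x rat_y rat_z), extend_subst (R4 rat_x rat_y rat_z),
      extend_subst (R5 rat_x rat_y rat_z)} \<subseteq> carrier (subgroup_generated birational_group
        {extend_subst (R1 rat_x rat_y rat_z), extend_subst (R2 rat_x rat_y rat_z)})"
    by (simp only: extend_subst_R1 extend_subst_R2 T1_T2 T2_T1 flip: T3_def T3_eq)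
  show "subgroup_generated birational_group
        {extend_subst (R1 rat_x rat_y rat_z), extend_subst (R2 rat_x rat_y rat_z)} \<cong> sym_group 3"
    unfolding extend_subst_R1 extend_subst_R2
    by (rule s3_generators_iso_sym_group[OF s3_generators_T1_T2])
qed (use s3_generators_T1_T2 in \<open>simp_all add: extend_subst_R1 extend_subst_R2
      s3_generators.a s3_generators.b s3_generators.ord_a s3_generators.ord_b\<close>)

end
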